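(* Let $\bar x\in\Gamma$ be a stationary point of (P) and let MSCQ hold at $\bar x$ with modulus $\sigma>0$. Let $\kappa>0$ and suppose that $$\langle(\nabla^2 f(\bar x)+\nabla^2\langle\lambda,g\rangle(\bar x))u,u\rangle>\frac1\kappa$$ for all multipliers $\lambda\in\tilde\Lambda:=\bigcup_{v\in K_\Gamma(\bar x,-\nabla f(\bar x))\cap\mathcal S}\Lambda(\bar x,-\nabla f(\bar x);v)$ and all $u\in\mathcal S$ satisfying $\langle\lambda,\nabla g(\bar x)u\rangle=0$ and $\lambda_0\big(\|\nabla g_r(\bar x)u\|^2-(\nabla g_0(\bar x)u)^2\big)=0$. Then $\bar x$ is a tilt-stable local minimizer of (P) with modulus $\kappa$.
   Context: Setting. Let $n,m\ge1$ and let $\mathcal Q:=\{(q_0,q_r)\in\mathbb R\times\mathbb R^m:\|q_r\|\le q_0\}$ be the second-order cone. For $q=(q_0,q_r)\in\mathbb R^{1+m}$ write $\hat q:=(-q_0,q_r)$, and let $\mathcal Q^*:=\{\hat q: q\in\mathcal Q\}=\{(q_0,q_r):\|q_r\|\le-q_0\}$. The normal cone to $\mathcal Q$ at $q\in\mathcal Q$ is $N_{\mathcal Q}(q)=\mathcal Q^*$ if $q=0$, $N_{\mathcal Q}(q)=\{0\}$ if $q\in\operatorname{int}\mathcal Q$, and $N_{\mathcal Q}(q)=\{\alpha\hat q:\alpha\ge0\}$ if $q\in\operatorname{bd}\mathcal Q\setminus\{0\}$. Problem (P) is: minimize $f(x)$ subject to $x\in\Gamma:=\{x\in\mathbb R^n: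 g(x)\in\mathcal Q\}$, where $f:\mathbb R^n\to\mathbb R$ and $g=(g_0,g_r):\mathbb R^n\to\mathbb R\times\mathbb R^m$ are $C^2$-smooth around a point $\bar x\in\Gamma$ with $g(\bar x)=0$. $\nabla g(x)$ is the Jacobian, $\nabla g(x)^*$ its transpose, $\nabla^2 g(x)(u,v)\in\mathbb R^{1+m}$ is the vector with components $u^T\nabla^2 g_i(x)v$, and $\nabla^2\langle\lambda,g\rangle(x)=\sum_i\lambda_i\nabla^2 g_i(x)$. $\mathcal S$ is the unit sphere. MSCQ. The metric subregularity constraint qualification (MSCQ) holds at $\bar x$ with modulus $\sigma>0$ if there is a neighborhood $U$ of $\bar x$ with $\operatorname{dist}(x;\Gamma)\le\sigma\operatorname{dist}(g(x);\mathcal Q)$ for all $x\in U$. Multipliers and cones. $T_\Gamma(x)$ is the Bouligand tangent cone $\{v:\exists t_k\downarrow0,\ v_k\to v,\ x+t_kv_k\in\Gamma\}$. For $x\in\Gamma$, $x^*\in\mathbb R^n$: $\Lambda(x,x^* ):=\{\lambda\in N_{\mathcal Q}(g(x)):\nabla g(x)^*\lambda=x^*\}$; the critical cone is $K_\Gamma(x,x^* ):=\{u\in T_\Gamma(x):\langle x^*,u\rangle=0\}$. The curvature mapping is $\mathcal H(x,\lambda):=\frac{-\lambda_0}{g_0(x)}\big(\nabla g_r(x)^*\nabla g_r(x)-\nabla g_0(x)^*\nabla g_0(x)\big)$ if $g(x)\in\operatorname{bd}\mathcal Q\setminus\{0\}$ and $\mathcal H(x,\lambda):=0$ otherwise. The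 directional multiplier set is $\Lambda(x,x^*;u):=\operatorname{argmax}_{\lambda\in\Lambda(x,x^* )}\langle(\nabla^2\langle\lambda,g\rangle(x)+\mathcal H(x,\lambda))u,u\rangle$. Stationarity and tilt stability. $\bar x$ is a stationary point of (P) if $-\nabla f(\bar x)\in N_\Gamma(\bar x)$, where $N_\Gamma$ is the limiting (Mordukhovich) normal cone. Let $\varphi:=f+\delta_\Gamma$ ($\delta_\Gamma$ the indicator function of $\Gamma$). $\bar x$ is a tilt-stable local minimizer of (P) with modulus $\kappa>0$ if there is $\gamma>0$ such that $M_\gamma(v^* ):=\operatorname{argmin}\{\varphi(x)-\langle v^*,x\rangle:\|x-\bar x\|\le\gamma\}$ is single-valued and Lipschitz continuous with constant $\kappa$ on a neighborhood of $0$, with $M_\gamma(0)=\{\bar x\}$. *)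

theory Defs
  imports "HOL-Analysis.Analysis"
begin

definition soc :: "(real \<times> (real^'m)) set" where
  "soc = {(q0, qr). norm qr \<le> q0}"

definition soc_polar :: "(real \<times> (real^'m)) set" where
  "soc_polar = {(q0, qr). norm qr \<le> - q0}"

definition soc_normal :: "real \<times> (real^'m) \<Rightarrow> (real \<times> (real^'m)) set" where
  "soc_normal q =
     (if q = 0 then soc_polar
      else if norm (snd q) < fst q then {0}
      else {(\<alpha> * (- fst q), \<alpha> *\<^sub>R snd q) | \<alpha>. \<alpha> \<ge> 0})"

definition C2_around ::
  "(real^'n \<Rightarrow> real) \<Rightarrow> (real^'n \<Rightarrow> real^'n) \<Rightarrow> (real^'n \<Rightarrow> real^'n^'n) \<Rightarrow> real^'n \<Rightarrow> bool" where
  "C2_around h h' h'' xb \<longleftrightarrow>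
     (\<exists>U. open U \<and> xb \<in> U \<and>
        (\<forall>x\<in>U. (h has_derivative (\<lambda>v. h' x \<bullet> v)) (at x) \<and>
                (h' has_derivative (\<lambda>v. h'' x *v v)) (at x)) \<and>
        continuous_on U h'')"

definition regular_normal :: "'a::euclidean_space set \<Rightarrow> 'a \<Rightarrow> 'a set" where
  "regular_normal S x = {v. x \<in> S \<and>
     (\<forall>e>0. \<exists>d>0. \<forall>y\<in>S. norm (y - x) < d \<longrightarrow> v \<bullet> (y - x) \<le> e * norm (y - x))}"

definition limiting_normal :: "'a::euclidean_space set \<Rightarrow> 'a \<Rightarrow> 'a set" where
  "limiting_normal S x = {v. \<exists>xs vs. (\<forall>k. xs k \<in> S \<and> vs k \<in> regular_normal S (xs k)) \<and>
        xs \<longlonglongrightarrow> x \<and> vs \<longlonglongrightarrow> v}"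

definition tangent_cone :: "'a::real_normed_vector set \<Rightarrow> 'a \<Rightarrow> 'a set" where
  "tangent_cone S x = {v. \<exists>t vs. (\<forall>k. t k > 0 \<and> x + t k *\<^sub>R vs k \<in> S) \<and>
        t \<longlonglongrightarrow> 0 \<and> vs \<longlonglongrightarrow> v}"

definition critical_cone :: "'a::real_inner set \<Rightarrow> 'a \<Rightarrow> 'a \<Rightarrow> 'a set" where
  "critical_cone S x xs = {u \<in> tangent_cone S x. xs \<bullet> u = 0}"

text \<open>Transposed Jacobian applied to a multiplier: nabla g(x)^* lambda,
  where g = (g0,gr), g0' is the gradient of g0 and gr' the Jacobian matrix (m x n) of gr.\<close>
definition jacT ::
  "(real^'n \<Rightarrow> real^'n) \<Rightarrow> (real^'n \<Rightarrow> real^'n^'m) \<Rightarrow> real^'n \<Rightarrow> real \<times> (real^'m) \<Rightarrow> real^'n" where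
  "jacT g0' gr' x lam = fst lam *\<^sub>R g0' x + (snd lam v* gr' x)"

definition mult_set ::
  "(real^'n \<Rightarrow> real) \<Rightarrow> (real^'n \<Rightarrow> real^'m) \<Rightarrow> (real^'n \<Rightarrow> real^'n) \<Rightarrow> (real^'n \<Rightarrow> real^'n^'m)
   \<Rightarrow> real^'n \<Rightarrow> real^'n \<Rightarrow> (real \<times> (real^'m)) set" where
  "mult_set g0 gr g0' gr' x xs =
     {lam \<in> soc_normal (g0 x, gr x). jacT g0' gr' x lam = xs}"

definition curv ::
  "(real^'n \<Rightarrow> real) \<Rightarrow> (real^'n \<Rightarrow> real^'m) \<Rightarrow> (real^'n \<Rightarrow> real^'n) \<Rightarrow> (real^'n \<Rightarrow> real^'n^'m)
   \<Rightarrow> real^'n \<Rightarrow> real \<times> (real^'m) \<Rightarrow> real^'n^'n" where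
  "curv g0 gr g0' gr' x lam =
     (if (g0 x, gr x) \<noteq> 0 \<and> norm (gr x) = g0 x
      then (- fst lam / g0 x) *\<^sub>R
             (transpose (gr' x) ** gr' x - (\<chi> i j. g0' x $ i * g0' x $ j))
      else 0)"

text \<open>Hessian of the Lagrangian term: nabla^2 <lambda,g>(x) = lambda0 nabla^2 g0(x) + sum_i lambda_i nabla^2 gr_i(x).\<close>
definition hess_mult ::
  "(real^'n \<Rightarrow> real^'n^'n) \<Rightarrow> (real^'n \<Rightarrow> 'm \<Rightarrow> real^'n^'n) \<Rightarrow> real^'n \<Rightarrow> real \<times> (real^'m) \<Rightarrow> real^'n^'n" where
  "hess_mult g0'' gr'' x lam = fst lam *\<^sub>R g0'' x + (\<Sum>i\<in>UNIV. (snd lam $ i) *\<^sub>R gr'' x i)"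

definition dir_mult_set ::
  "(real^'n \<Rightarrow> real) \<Rightarrow> (real^'n \<Rightarrow> real^'m) \<Rightarrow> (real^'n \<Rightarrow> real^'n) \<Rightarrow> (real^'n \<Rightarrow> real^'n^'m)
   \<Rightarrow> (real^'n \<Rightarrow> real^'n^'n) \<Rightarrow> (real^'n \<Rightarrow> 'm \<Rightarrow> real^'n^'n)
   \<Rightarrow> real^'n \<Rightarrow> real^'n \<Rightarrow> real^'n \<Rightarrow> (real \<times> (real^'m)) set" where
  "dir_mult_set g0 gr g0' gr' g0'' gr'' x xs u =
     (let q = (\<lambda>lam. ((hess_mult g0'' gr'' x lam + curv g0 gr g0' gr' x lam) *v u) \<bullet> u)
      in {lam \<in> mult_set g0 gr g0' gr' x xs. \<forall>mu \<in> mult_set g0 gr g0' gr' x xs. q mu \<le> q lam})"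

definition MSCQ :: "(real^'n \<Rightarrow> real) \<Rightarrow> (real^'n \<Rightarrow> real^'m) \<Rightarrow> real^'n \<Rightarrow> real \<Rightarrow> bool" where
  "MSCQ g0 gr xb sgm \<longleftrightarrow>
     (\<exists>U. open U \<and> xb \<in> U \<and>
        (\<forall>x\<in>U. infdist x {y. (g0 y, gr y) \<in> soc} \<le> sgm * infdist (g0 x, gr x) soc))"

definition tilt_argmin :: "(real^'n \<Rightarrow> real) \<Rightarrow> (real^'n) set \<Rightarrow> real^'n \<Rightarrow> real \<Rightarrow> real^'n \<Rightarrow> (real^'n) set" where
  "tilt_argmin f G xb gm vs =
     {x \<in> G \<inter> cball xb gm. \<forall>y \<in> G \<inter> cball xb gm. f x - vs \<bullet> x \<le> f y - vs \<bullet> y}"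

definition tilt_stable :: "(real^'n \<Rightarrow> real) \<Rightarrow> (real^'n) set \<Rightarrow> real^'n \<Rightarrow> real \<Rightarrow> bool" where
  "tilt_stable f G xb kappa \<longleftrightarrow>
     (\<exists>gm>0. tilt_argmin f G xb gm 0 = {xb} \<and>
        (\<exists>V. open V \<and> 0 \<in> V \<and>
           (\<forall>v\<in>V. \<exists>x. tilt_argmin f G xb gm v = {x}) \<and>
           (\<forall>v\<in>V. \<forall>w\<in>V. \<forall>x y. tilt_argmin f G xb gm v = {x} \<longrightarrow>
                tilt_argmin f G xb gm w = {y} \<longrightarrow> dist x y \<le> kappa * dist v w)))"

end

theory Submission
  imports Defs
begin

text \<open>
  Minimizers of the tilted problems near \<open>xb\<close> carry multipliers bounded by the subregularity
  modulus, so it suffices to show that the map from KKT points to tilts is strongly monotone with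
  constant \<open>1/kappa\<close> near \<open>xb\<close>.  Suppose two sequences of KKT points \<open>x k \<noteq> y k\<close> violate this,
  with multipliers tending to \<open>L\<close> and \<open>M\<close> and normalized differences tending to \<open>w\<close>.  A second-order
  expansion bounds the average of the two Lagrangian Hessians at \<open>w\<close> by \<open>1/kappa\<close>, and forces
  \<open>l k \<bullet> G (y k)\<close> and \<open>m k \<bullet> G (x k)\<close> to be of second order in the distance, which by the geometry of
  the cone makes \<open>w\<close> satisfy the side conditions for both \<open>L\<close> and \<open>M\<close>.  Moreover the
  multiplier limit along feasible points \<open>x k \<noteq> xb\<close> is a directional multiplier in the limit direction
  of \<open>x k - xb\<close>: any competing multiplier lies on an open segment interior to the polar cone, which is
  stable under the perturbation \<open>l k - L\<close>.  Hence the second-order condition applies to both limits.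
\<close>

section \<open>Multipliers under metric subregularity\<close>

text \<open>The obstacle is the point \<open>xb\<close> itself. A KKT point equal to
  \<open>xb\<close> has no direction of approach, so the limit of its multipliers need not belong to
  the set on which the second-order condition is assumed. Only one point of a violating pair can be
  \<open>xb\<close>; there \<open>G\<close> vanishes and the Jacobian is constant, so its
  multipliers can be moved inside their fibre of \<open>jacT\<close> towards the limit
  \<open>M\<close> of the other point. Both this exchange and the directional argument use strict
  convexity of the polar cone along fibres with nonzero image. If the image is \<open>0\<close>, the
  norm bound on the multipliers forces the limit to be \<open>0\<close> instead. Strong monotonicity
  yields uniqueness and the Lipschitz constant, but it does not show that \<open>xb\<close> solves
  the problem with tilt \<open>0\<close>: stationarity is meant in the limiting sense. Strict local
  minimality therefore needs its own argument, where a feasible point no worse than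
  \<open>xb\<close> is first replaced by one that carries a multiplier.\<close>

lemma convergent_subseq_bounded:
  fixes s :: "nat \<Rightarrow> 'a::heine_borel"
  assumes "bounded (range s)"
  obtains l r where "strict_mono (r :: nat \<Rightarrow> nat)" "(\<lambda>k. s (r k)) \<longlonglongrightarrow> l"
  using bounded_imp_convergent_subsequence[OF assms] by (metis comp_def ext)

lemma tendsto_zero_inverse_Suc:
  fixes s :: "nat \<Rightarrow> 'a::real_normed_vector"
  assumes "\<And>k. norm (s k) < inverse (real (Suc k))"
  shows "s \<longlonglongrightarrow> 0"
  by (rule Lim_null_comparison[OF _ LIMSEQ_inverse_real_of_nat])
    (use assms in \<open>auto intro!: always_eventually less_imp_le\<close>)

lemma bounded_range_sgn: "bounded (range (\<lambda>k. sgn (a k :: 'a::real_normed_vector)))"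
  by (auto simp: bounded_iff norm_sgn intro!: exI[of _ 1])

lemma has_derivative_directional_seq:
  fixes G :: "'a::real_normed_vector \<Rightarrow> 'b::real_normed_vector"
  assumes D: "(G has_derivative D) (at x)" and t: "\<And>k. t k > 0" "t \<longlonglongrightarrow> (0::real)"
  shows "(\<lambda>k. (G (x + t k *\<^sub>R u) - G x) /\<^sub>R t k) \<longlonglongrightarrow> D u"
proof -
  have lin: "bounded_linear D" using D by (rule has_derivative_bounded_linear)
  have "((\<lambda>s. x + s *\<^sub>R u) has_derivative (\<lambda>s. s *\<^sub>R u)) (at 0)"
    by (auto intro!: derivative_eq_intros)
  then have "((\<lambda>s. G (x + s *\<^sub>R u)) has_derivative (\<lambda>s. D (s *\<^sub>R u))) (at 0)"
    using has_derivative_compose[of "\<lambda>s. x + s *\<^sub>R u" _ 0 UNIV G D] D by simp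
  then have "((\<lambda>h. norm (G (x + h *\<^sub>R u) - G x - D (h *\<^sub>R u)) / norm h) \<longlongrightarrow> 0) (at 0)"
    by (simp add: has_derivative_at)
  moreover have "filterlim t (at 0) sequentially"
    using t by (auto simp: filterlim_at less_imp_neq[symmetric])
  ultimately have "(\<lambda>k. norm (G (x + t k *\<^sub>R u) - G x - D (t k *\<^sub>R u)) / norm (t k)) \<longlonglongrightarrow> 0"
    by (rule filterlim_compose)
  moreover have "norm (G (x + t k *\<^sub>R u) - G x - D (t k *\<^sub>R u)) / norm (t k)
      = norm ((G (x + t k *\<^sub>R u) - G x) /\<^sub>R t k - D u)" for k
  proof -
    have "(G (x + t k *\<^sub>R u) - G x) /\<^sub>R t k - D u
        = (G (x + t k *\<^sub>R u) - G x - D (t k *\<^sub>R u)) /\<^sub>R t k"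
      using t(1)[of k] linear_cmul[OF bounded_linear.linear[OF lin]] by (simp add: scaleR_diff_right)
    then show ?thesis by (simp add: divide_inverse mult.commute)
  qed
  ultimately show ?thesis
    by (simp add: LIM_zero_iff tendsto_norm_zero_iff)
qed

text \<open>If \<open>v\<close> were outside the compact convex set of images of bounded normals, a
  separating direction \<open>u\<close> would exist. Along \<open>x + t u\<close> subregularity
  bounds the distance to the feasible set by \<open>s\<close> times the distance to
  \<open>Q\<close>, and unit normals at projections onto \<open>Q\<close> converge to a normal at
  \<open>G x\<close> that violates the separation.\<close>

lemma regular_normal_multiplier:
  fixes G :: "'a::euclidean_space \<Rightarrow> 'b::euclidean_space"
  assumes Q: "closed Q" "convex Q" and D: "(G has_derivative D) (at x)"
    and U: "open U" "x \<in> U"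
    and sub: "\<And>y. y \<in> U \<Longrightarrow> infdist y {y. G y \<in> Q} \<le> s * infdist (G y) Q"
    and s: "s \<ge> 0" and v: "v \<in> regular_normal {y. G y \<in> Q} x"
  obtains lam where "\<And>p. p \<in> Q \<Longrightarrow> lam \<bullet> (p - G x) \<le> 0" "\<And>u. lam \<bullet> D u = v \<bullet> u"
    "norm lam \<le> s * norm v"
proof -
  let ?S = "{y. G y \<in> Q}"
  define N where "N = {lam. \<forall>p\<in>Q. lam \<bullet> (p - G x) \<le> 0}"
  \<comment> \<open>Intersecting with the ball makes \<open>C\<close> compact and hence closed; the
    image of the whole cone \<open>N\<close> may fail to be closed.\<close>
  define C where "C = adjoint D ` (N \<inter> cball 0 (s * norm v))"
  have xS: "G x \<in> Q" using v by (auto simp: regular_normal_def)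
  have blin: "bounded_linear D" using D by (rule has_derivative_bounded_linear)
  then have lin: "linear D" by (rule bounded_linear.linear)
  have N_eq: "N = (\<Inter>p\<in>Q. {lam. (p - G x) \<bullet> lam \<le> 0})"
    by (auto simp: N_def inner_commute)
  have "closed N" unfolding N_eq by (intro closed_INT ballI closed_halfspace_le)
  moreover have "convex N" unfolding N_eq by (intro convex_INT convex_halfspace_le)
  ultimately have C: "closed C" "convex C"
    unfolding C_def
    by (auto intro!: compact_imp_closed compact_continuous_image closed_Int_compact
        linear_continuous_on linear_conv_bounded_linear[THEN iffD1] adjoint_linear lin
        convex_linear_image convex_Int)
  have "v \<in> C"
  proof (rule ccontr)
    assume "v \<notin> C"
    then obtain a b where ab: "a \<bullet> v < b" "\<And>c. c \<in> C \<Longrightarrow> b < a \<bullet> c"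
      using separating_hyperplane_closed_point[OF C(2,1)] by blast
    define u where "u = - a"
    have sep: "lam \<bullet> D u < v \<bullet> u" if "lam \<in> N" "norm lam \<le> s * norm v" for lam
    proof -
      have "b < a \<bullet> adjoint D lam" using ab(2) that by (auto simp: C_def)
      then have "- b > lam \<bullet> D u"
        using adjoint_works[OF lin, of u lam] by (simp add: u_def inner_commute)
      with ab(1) show ?thesis by (simp add: u_def inner_commute)
    qed
    define t where "t k = inverse (real (Suc k))" for k
    have t: "t k > 0" for k by (simp add: t_def)
    have t0: "t \<longlonglongrightarrow> 0" unfolding t_def by (rule LIMSEQ_inverse_real_of_nat)
    define y where "y k = x + t k *\<^sub>R u" for k
    define z where "z k = closest_point Q (G (y k))" for k
    \<comment> \<open>The value is \<open>0\<close> when \<open>G (y k)\<close> already lies in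
      \<open>Q\<close>, which is why the limit satisfies only \<open>norm l \<le> 1\<close>.\<close>
    define e where "e k = sgn (G (y k) - z k)" for k
    have zQ: "z k \<in> Q" for k
      unfolding z_def using Q(1) xS by (intro closest_point_in_set) auto
    \<comment> \<open>\<open>G\<close> is assumed differentiable at \<open>x\<close> only, so
      \<open>?S\<close> may fail to be closed and a nearest point may not exist. The error
      \<open>(t k)\<^sup>2\<close> vanishes after division by \<open>t k\<close>.\<close>
    have "\<exists>p. p \<in> ?S \<and> dist (y k) p < infdist (y k) ?S + (t k)\<^sup>2" for k
    proof -
      have "?S \<noteq> {}" "(t k)\<^sup>2 > 0" using xS t[of k] by auto
      then show ?thesis unfolding infdist_notempty[OF \<open>?S \<noteq> {}\<close>]
        using cInf_lessD[of "(\<lambda>a. dist (y k) a) ` ?S" "(INF a\<in>?S. dist (y k) a) + (t k)\<^sup>2"]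
        by auto
    qed
    then obtain p where p: "\<And>k. p k \<in> ?S" "\<And>k. dist (y k) (p k) < infdist (y k) ?S + (t k)\<^sup>2"
      by metis
    have "bounded (range e)" unfolding e_def by (rule bounded_range_sgn)
    then obtain l r where r: "strict_mono r" and l: "(\<lambda>k. e (r k)) \<longlonglongrightarrow> l"
      by (rule convergent_subseq_bounded)
    have quot: "(\<lambda>k. (G (y k) - G x) /\<^sub>R t k) \<longlonglongrightarrow> D u"
      unfolding y_def by (rule has_derivative_directional_seq[OF D t t0])
    have y_x: "y \<longlonglongrightarrow> x"
      using tendsto_add[OF tendsto_const[of x] tendsto_scaleR[OF t0 tendsto_const[of u]]]
      by (simp add: y_def[abs_def])
    have Gy: "(\<lambda>k. G (y k)) \<longlonglongrightarrow> G x"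
      using isCont_tendsto_compose[OF has_derivative_continuous[OF D] y_x] by simp
    have dist_z: "norm (G (y k) - z k) \<le> norm (G (y k) - G x)" for k
      using closest_point_le[OF Q(1) xS, of "G (y k)"] by (simp add: z_def dist_norm)
    have e_nonpos: "e k \<bullet> (q - z k) \<le> 0" if "q \<in> Q" for q k
      using closest_point_dot[OF Q(2,1) that, of "G (y k)"]
      by (simp add: e_def z_def sgn_div_norm mult_nonneg_nonpos)
    have e_norm: "e k \<bullet> (G (y k) - z k) = norm (G (y k) - z k)" for k
      by (cases "G (y k) = z k") (simp_all add: e_def sgn_div_norm dot_square_norm power2_eq_square)
    have dist_le: "norm (G (y k) - z k) \<le> e k \<bullet> (G (y k) - G x)" for k
      using e_nonpos[OF xS, of k] e_norm[of k] by (simp add: inner_diff_right)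
    have l_norm: "norm l \<le> 1"
      by (rule LIMSEQ_le_const2[OF tendsto_norm[OF l]]) (auto simp: e_def norm_sgn)
    have Gyr: "(\<lambda>k. G (y (r k))) \<longlonglongrightarrow> G x" using LIMSEQ_subseq_LIMSEQ[OF Gy r] by (simp add: o_def)
    have quot_r: "(\<lambda>k. (G (y (r k)) - G x) /\<^sub>R t (r k)) \<longlonglongrightarrow> D u"
      using LIMSEQ_subseq_LIMSEQ[OF quot r] by (simp add: o_def)
    have t0r: "(\<lambda>k. t (r k)) \<longlonglongrightarrow> 0" using LIMSEQ_subseq_LIMSEQ[OF t0 r] by (simp add: o_def)
    have yr: "(\<lambda>k. y (r k)) \<longlonglongrightarrow> x" using LIMSEQ_subseq_LIMSEQ[OF y_x r] by (simp add: o_def)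
    have zr: "(\<lambda>k. z (r k)) \<longlonglongrightarrow> G x"
    proof -
      have "(\<lambda>k. norm (G (y (r k)) - G x)) \<longlonglongrightarrow> 0"
        using Gyr by (simp add: LIM_zero tendsto_norm_zero)
      then have "(\<lambda>k. G (y (r k)) - z (r k)) \<longlonglongrightarrow> 0"
        by (rule Lim_null_comparison[rotated]) (use dist_z in auto)
      from tendsto_diff[OF Gyr this] show ?thesis by simp
    qed
    have "l \<in> N" unfolding N_def
    proof safe
      fix q assume "q \<in> Q"
      have "(\<lambda>k. e (r k) \<bullet> (q - z (r k))) \<longlonglongrightarrow> l \<bullet> (q - G x)"
        by (intro tendsto_intros l zr)
      then show "l \<bullet> (q - G x) \<le> 0"
        by (rule LIMSEQ_le_const2) (use e_nonpos \<open>q \<in> Q\<close> in blast)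
    qed
    \<comment> \<open>The normal that contradicts \<open>sep\<close>: the limit \<open>l\<close>,
      scaled by the radius of the ball in \<open>C\<close>.\<close>
    then have "(s * norm v) *\<^sub>R l \<in> N" using s by (auto simp: N_def mult_nonneg_nonpos)
    moreover have "norm ((s * norm v) *\<^sub>R l) \<le> s * norm v"
      using l_norm s by (simp add: mult_left_le)
    ultimately have strict: "s * norm v * (l \<bullet> D u) < v \<bullet> u" using sep by fastforce
    define q where "q k = e (r k) \<bullet> ((G (y (r k)) - G x) /\<^sub>R t (r k))" for k
    have q: "q \<longlonglongrightarrow> l \<bullet> D u" unfolding q_def by (intro tendsto_intros l quot_r)
    define B where "B k = s * q k + t (r k)" for k
    have B: "B \<longlonglongrightarrow> s * (l \<bullet> D u)"
      unfolding B_def using tendsto_add[OF tendsto_mult_left[OF q] t0r] by simp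
    have evU: "\<forall>\<^sub>F k in sequentially. y (r k) \<in> U"
      using topological_tendstoD[OF yr U] .
    have pB: "\<forall>\<^sub>F k in sequentially. norm (y (r k) - p (r k)) \<le> t (r k) * B k"
      using evU
    proof eventually_elim
      case (elim k)
      have "infdist (G (y (r k))) Q \<le> norm (G (y (r k)) - z (r k))"
        using infdist_le[OF zQ, of "G (y (r k))" "r k"] by (simp add: dist_norm)
      also have "\<dots> \<le> e (r k) \<bullet> (G (y (r k)) - G x)" by (rule dist_le)
      also have "\<dots> = t (r k) * q k" using t[of "r k"] by (simp add: q_def)
      finally have "s * infdist (G (y (r k))) Q \<le> s * (t (r k) * q k)"
        using s by (rule mult_left_mono)
      then have "infdist (y (r k)) ?S \<le> s * (t (r k) * q k)" using sub[OF elim] by linarith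
      with p(2)[of "r k"] show ?case
        by (simp add: dist_norm B_def algebra_simps power2_eq_square)
    qed
    have p_x: "(\<lambda>k. p (r k)) \<longlonglongrightarrow> x"
    proof -
      have "(\<lambda>k. t (r k) * B k) \<longlonglongrightarrow> 0" using tendsto_mult[OF t0r B] by simp
      with pB have "(\<lambda>k. y (r k) - p (r k)) \<longlonglongrightarrow> 0" by (rule Lim_null_comparison)
      from tendsto_diff[OF yr this] show ?thesis by simp
    qed
    \<comment> \<open>The regular normal inequality applies to the feasible point
      \<open>p (r k)\<close>; the detour from \<open>y (r k)\<close> costs at most
      \<open>t (r k) * B k\<close>, and division by \<open>t (r k)\<close> leaves the limit of
      \<open>B\<close>.\<close>
    have "v \<bullet> u \<le> \<epsilon> * (s * (l \<bullet> D u) + norm u) + norm v * (s * (l \<bullet> D u))" if "\<epsilon> > 0" for \<epsilon>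
    proof -
      obtain d where d: "d > 0" "\<And>y. y \<in> ?S \<Longrightarrow> norm (y - x) < d \<Longrightarrow> v \<bullet> (y - x) \<le> \<epsilon> * norm (y - x)"
        using v \<open>\<epsilon> > 0\<close> by (auto simp: regular_normal_def)
      have "\<forall>\<^sub>F k in sequentially. dist (p (r k)) x < d" using p_x d(1) by (rule tendstoD)
      with pB have "\<forall>\<^sub>F k in sequentially. v \<bullet> u \<le> \<epsilon> * (B k + norm u) + norm v * B k"
      proof eventually_elim
        case (elim k)
        have "t (r k) * (v \<bullet> u) = v \<bullet> (p (r k) - x) + v \<bullet> (y (r k) - p (r k))"
          by (simp add: y_def inner_diff_right inner_add_right)
        also have "v \<bullet> (p (r k) - x) \<le> \<epsilon> * norm (p (r k) - x)"
          using d(2)[OF p(1)] elim(2) by (simp add: dist_norm)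
        also have "norm (p (r k) - x) \<le> norm (p (r k) - y (r k)) + norm (y (r k) - x)"
          using norm_triangle_ineq[of "p (r k) - y (r k)" "y (r k) - x"] by simp
        also have "norm (p (r k) - y (r k)) + norm (y (r k) - x) \<le> t (r k) * (B k + norm u)"
          using elim(1) t[of "r k"] by (simp add: y_def norm_minus_commute algebra_simps)
        also have "v \<bullet> (y (r k) - p (r k)) \<le> norm v * (t (r k) * B k)"
          using elim(1) by (meson norm_cauchy_schwarz mult_left_mono norm_ge_zero order_trans)
        finally have "t (r k) * (v \<bullet> u) \<le> t (r k) * (\<epsilon> * (B k + norm u) + norm v * B k)"
          using \<open>\<epsilon> > 0\<close> by (simp add: algebra_simps)
        then show ?case using t[of "r k"] by simp
      qed
      moreover have "(\<lambda>k. \<epsilon> * (B k + norm u) + norm v * B k) \<longlonglongrightarrow>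
          \<epsilon> * (s * (l \<bullet> D u) + norm u) + norm v * (s * (l \<bullet> D u))"
        by (intro tendsto_intros B)
      ultimately show ?thesis using tendsto_lowerbound sequentially_bot by blast
    qed
    then have bound: "v \<bullet> u \<le> t k * (s * (l \<bullet> D u) + norm u) + norm v * (s * (l \<bullet> D u))" for k
      using t by blast
    have "(\<lambda>k. t k * (s * (l \<bullet> D u) + norm u) + norm v * (s * (l \<bullet> D u)))
        \<longlonglongrightarrow> 0 * (s * (l \<bullet> D u) + norm u) + norm v * (s * (l \<bullet> D u))"
      by (intro tendsto_intros t0)
    then have "v \<bullet> u \<le> 0 * (s * (l \<bullet> D u) + norm u) + norm v * (s * (l \<bullet> D u))"
      by (rule LIMSEQ_le_const) (use bound in blast)
    with strict show False by (simp add: mult_ac)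
  qed
  then obtain lam where "lam \<in> N" "norm lam \<le> s * norm v" "v = adjoint D lam"
    by (auto simp: C_def)
  then show thesis
    using adjoint_works[OF lin] by (intro that[of lam]) (auto simp: N_def inner_commute)
qed

section \<open>The second-order cone\<close>

lemma soc_iff: "q \<in> soc \<longleftrightarrow> norm (snd q) \<le> fst q"
  by (cases q) (simp add: soc_def)

lemma soc_polar_iff: "q \<in> soc_polar \<longleftrightarrow> norm (snd q) \<le> - fst q"
  by (cases q) (simp add: soc_polar_def)

lemma closed_soc: "closed (soc :: (real \<times> (real^'m)) set)"
proof -
  have eq: "(soc :: (real \<times> (real^'m)) set) = {q. norm (snd q) \<le> fst q}" by (auto simp: soc_iff)
  show ?thesis unfolding eq by (intro closed_Collect_le continuous_intros)
qed

lemma closed_soc_polar: "closed (soc_polar :: (real \<times> (real^'m)) set)"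
proof -
  have eq: "(soc_polar :: (real \<times> (real^'m)) set) = {q. norm (snd q) \<le> - fst q}"
    by (auto simp: soc_polar_iff)
  show ?thesis unfolding eq by (intro closed_Collect_le continuous_intros)
qed

lemma soc_add: "p \<in> soc \<Longrightarrow> q \<in> soc \<Longrightarrow> p + q \<in> soc"
  using norm_triangle_ineq[of "snd p" "snd q"] by (simp add: soc_iff)

lemma soc_scaleR: "0 \<le> c \<Longrightarrow> q \<in> soc \<Longrightarrow> c *\<^sub>R q \<in> soc"
  by (simp add: soc_iff mult_left_mono)

lemma convex_soc: "convex (soc :: (real \<times> (real^'m)) set)"
  by (rule convexI) (intro soc_add soc_scaleR)

lemma soc_polar_add: "p \<in> soc_polar \<Longrightarrow> q \<in> soc_polar \<Longrightarrow> p + q \<in> soc_polar"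
  using norm_triangle_ineq[of "snd p" "snd q"] by (simp add: soc_polar_iff)

lemma soc_polar_fst_nonpos: "q \<in> soc_polar \<Longrightarrow> fst q \<le> 0"
  using norm_ge_zero[of "snd q"] by (simp add: soc_polar_iff del: norm_ge_zero)

lemma soc_polar_inner_nonpos:
  assumes "l \<in> soc_polar" "q \<in> soc"
  shows "l \<bullet> q \<le> 0"
proof -
  have "snd l \<bullet> snd q \<le> norm (snd l) * norm (snd q)" by (rule norm_cauchy_schwarz)
  also have "\<dots> \<le> (- fst l) * fst q"
    using assms soc_polar_fst_nonpos[OF assms(1)] by (intro mult_mono) (auto simp: soc_iff soc_polar_iff)
  finally show ?thesis by (simp add: inner_prod_def)
qed

text \<open>Testing the variational inequality at \<open>0\<close> and at twice \<open>q\<close>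
  gives orthogonality, hence nonpositivity on the whole cone; the boundary point
  \<open>(norm (snd l), snd l)\<close> is then the decisive test.\<close>

lemma soc_normal_coneD:
  assumes "\<And>p. p \<in> soc \<Longrightarrow> l \<bullet> (p - q) \<le> 0" "q \<in> soc"
  shows "l \<in> soc_polar" "l \<bullet> q = 0"
proof -
  show lq: "l \<bullet> q = 0"
    using assms(1)[of 0] assms(1)[OF soc_scaleR[of 2 q]] assms(2)
    by (simp add: soc_iff inner_diff_right)
  then have le: "l \<bullet> p \<le> 0" if "p \<in> soc" for p
    using assms(1)[OF that] by (simp add: inner_diff_right)
  show "l \<in> soc_polar"
  proof (cases "snd l = 0")
    case True
    then show ?thesis using le[of "(1, 0)"] by (simp add: soc_iff soc_polar_iff inner_prod_def)
  next
    case False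
    have "norm (snd l) * (fst l + norm (snd l)) \<le> 0"
      using le[of "(norm (snd l), snd l)"]
      by (simp add: soc_iff inner_prod_def dot_square_norm power2_eq_square algebra_simps)
    then have "fst l + norm (snd l) \<le> 0"
      using False by (simp add: mult_le_0_iff)
    then show ?thesis by (simp add: soc_polar_iff)
  qed
qed

section \<open>The Lorentz form and strict convexity of the polar cone along fibres\<close>

text \<open>The Lorentz form, nonnegative on the cone. At \<open>DG xb u\<close> it is the negative
  of the bracket in the second side condition.\<close>

definition lorentz :: "real \<times> 'b::real_inner \<Rightarrow> real" where
  "lorentz q = (fst q)\<^sup>2 - (norm (snd q))\<^sup>2"

lemma lorentz_nonneg: "q \<in> soc \<Longrightarrow> 0 \<le> lorentz q"
  by (auto simp: soc_iff lorentz_def intro!: power_mono)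

lemma lorentz_scaleR: "lorentz (c *\<^sub>R q) = c\<^sup>2 * lorentz q"
  by (simp add: lorentz_def power_mult_distrib algebra_simps)

lemma tendsto_lorentz [tendsto_intros]:
  "(q \<longlongrightarrow> a) F \<Longrightarrow> ((\<lambda>x. lorentz (q x)) \<longlongrightarrow> lorentz a) F"
  unfolding lorentz_def by (intro tendsto_intros)

text \<open>For \<open>fst l \<noteq> 0\<close>, Cauchy-Schwarz keeps a vector orthogonal to
  \<open>l\<close> out of the interior of the cone and of its negative, so both factors are
  nonpositive.\<close>

lemma lorentz_orthogonal:
  assumes "l \<in> soc_polar" "l \<bullet> e = 0"
  shows "0 \<le> fst l * lorentz e"
proof (cases "fst l = 0")
  case False
  have "\<bar>fst l\<bar> * \<bar>fst e\<bar> = \<bar>snd l \<bullet> snd e\<bar>"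
    using assms(2) by (simp add: inner_prod_def abs_mult[symmetric])
  also have "\<dots> \<le> norm (snd l) * norm (snd e)" by (rule Cauchy_Schwarz_ineq2)
  also have "\<dots> \<le> \<bar>fst l\<bar> * norm (snd e)"
    using assms(1) by (intro mult_right_mono) (auto simp: soc_polar_iff)
  finally have "\<bar>fst e\<bar> \<le> norm (snd e)" using False by simp
  then have "lorentz e \<le> 0" by (simp add: lorentz_def abs_le_square_iff[symmetric])
  moreover have "fst l \<le> 0" using assms(1) by (rule soc_polar_fst_nonpos)
  ultimately show ?thesis by (simp add: mult_nonpos_nonpos)
qed simp

text \<open>Complementarity of \<open>l\<close> and \<open>p\<close> is an equality case of
  Cauchy-Schwarz and makes \<open>fst p *\<^sub>R snd l\<close> equal to
  \<open>- (fst l *\<^sub>R snd p)\<close>. Hence \<open>fst p * (l \<bullet> q)\<close> is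
  \<open>fst l\<close> times the Lorentz product of \<open>p\<close> and \<open>q\<close>, the cross
  term in \<open>lorentz (q - p)\<close>; the remaining squares have the right sign. In this way a
  second-order bound on \<open>l \<bullet> q\<close> controls the Lorentz form of the
  difference.\<close>

lemma lorentz_diff_ge:
  assumes l: "l \<in> soc_polar" and p: "p \<in> soc" and q: "q \<in> soc" and lp: "l \<bullet> p = 0"
  shows "- fst l * lorentz (q - p) \<ge> 2 * fst p * (l \<bullet> q)"
proof -
  have nl: "norm (snd l) \<le> - fst l" and np: "norm (snd p) \<le> fst p"
    using l p by (auto simp: soc_polar_iff soc_iff)
  have c: "snd l \<bullet> snd p = - fst l * fst p" using lp by (simp add: inner_prod_def)
  have "(norm (fst p *\<^sub>R snd l + fst l *\<^sub>R snd p))\<^sup>2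
      = (fst p)\<^sup>2 * (norm (snd l))\<^sup>2 + (fst l)\<^sup>2 * (norm (snd p))\<^sup>2 - 2 * (fst p)\<^sup>2 * (fst l)\<^sup>2"
    unfolding power2_norm_eq_inner inner_add_left inner_add_right inner_scaleR_left inner_scaleR_right
    using c by (simp add: inner_commute[of "snd p" "snd l"] power2_eq_square algebra_simps)
  also have "\<dots> \<le> (fst p)\<^sup>2 * (- fst l)\<^sup>2 + (fst l)\<^sup>2 * (fst p)\<^sup>2 - 2 * (fst p)\<^sup>2 * (fst l)\<^sup>2"
    using nl np by (intro diff_right_mono add_mono mult_left_mono power_mono) auto
  finally have "fst p *\<^sub>R snd l + fst l *\<^sub>R snd p = 0" by simp
  then have eq: "fst p *\<^sub>R snd l = - (fst l *\<^sub>R snd p)" by (simp add: add_eq_0_iff2)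
  have "fst p * (l \<bullet> q) = fst l * fst p * fst q + (fst p *\<^sub>R snd l) \<bullet> snd q"
    by (simp add: inner_prod_def algebra_simps)
  also have "\<dots> = fst l * (fst p * fst q - snd p \<bullet> snd q)"
    unfolding eq by (simp add: algebra_simps)
  finally have *: "fst p * (l \<bullet> q) = fst l * (fst p * fst q - snd p \<bullet> snd q)" .
  have "lorentz (q - p) = lorentz q + lorentz p - 2 * (fst p * fst q - snd p \<bullet> snd q)"
    unfolding lorentz_def power2_norm_eq_inner
    by (simp add: inner_diff_left inner_diff_right inner_commute power2_eq_square algebra_simps)
  then have "- fst l * lorentz (q - p)
      = - fst l * (lorentz q + lorentz p) + 2 * (fst p * (l \<bullet> q))"
    unfolding * by algebra
  moreover have "0 \<le> - fst l * (lorentz q + lorentz p)"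
    using soc_polar_fst_nonpos[OF l] lorentz_nonneg[OF p] lorentz_nonneg[OF q]
    by (intro mult_nonneg_nonneg) linarith+
  ultimately show ?thesis by linarith
qed

text \<open>A combination on the boundary forces equality in the triangle inequality, so
  \<open>l\<close> and \<open>m\<close> lie on one boundary ray. The common nonzero image under
  \<open>J\<close> fixes the scale on that ray and gives \<open>l = m\<close>; with image
  \<open>0\<close>, different points of one ray could not be told apart.\<close>

lemma soc_polar_strict_convex:
  assumes l: "l \<in> soc_polar" and m: "m \<in> soc_polar" and e: "0 < e" "e < 1"
    and lin: "linear J" and J: "J l = J m" "J l \<noteq> (0::'b::real_vector)" and ne: "l \<noteq> m"
  shows "norm (snd ((1 - e) *\<^sub>R l + e *\<^sub>R m)) < - fst ((1 - e) *\<^sub>R l + e *\<^sub>R m)"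
proof (rule ccontr)
  assume "\<not> ?thesis"
  then have ge: "norm ((1 - e) *\<^sub>R snd l + e *\<^sub>R snd m) \<ge> (1 - e) * (- fst l) + e * (- fst m)"
    by (simp add: algebra_simps)
  have nl: "norm (snd l) \<le> - fst l" and nm: "norm (snd m) \<le> - fst m"
    using l m by (auto simp: soc_polar_iff)
  have tri: "norm ((1 - e) *\<^sub>R snd l + e *\<^sub>R snd m) \<le> (1 - e) * norm (snd l) + e * norm (snd m)"
    using norm_triangle_ineq[of "(1 - e) *\<^sub>R snd l" "e *\<^sub>R snd m"] e by simp
  have lel: "(1 - e) * norm (snd l) \<le> (1 - e) * (- fst l)" "e * norm (snd m) \<le> e * (- fst m)"
    using nl nm e by (intro mult_left_mono; simp)+
  have "(1 - e) * norm (snd l) = (1 - e) * (- fst l)" "e * norm (snd m) = e * (- fst m)"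
    using ge tri lel by linarith+
  then have eqs: "norm (snd l) = - fst l" "norm (snd m) = - fst m"
    using e mult_cancel_left[of "1 - e" "norm (snd l)" "- fst l"]
      mult_cancel_left[of e "norm (snd m)" "- fst m"] by auto
  have "norm ((1 - e) *\<^sub>R snd l + e *\<^sub>R snd m) = norm ((1 - e) *\<^sub>R snd l) + norm (e *\<^sub>R snd m)"
    using ge tri eqs e by simp
  then have "norm ((1 - e) *\<^sub>R snd l) *\<^sub>R (e *\<^sub>R snd m) = norm (e *\<^sub>R snd m) *\<^sub>R ((1 - e) *\<^sub>R snd l)"
    by (rule norm_triangle_eq[THEN iffD1])
  then have "((1 - e) * e) *\<^sub>R (norm (snd l) *\<^sub>R snd m) = ((1 - e) * e) *\<^sub>R (norm (snd m) *\<^sub>R snd l)"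
    using e by (simp add: mult_ac)
  then have col: "norm (snd l) *\<^sub>R snd m = norm (snd m) *\<^sub>R snd l"
    using e by (subst (asm) scaleR_cancel_left) auto
  \<comment> \<open>Both first components are minus the norms by \<open>eqs\<close>, so collinearity
    of the vector parts extends to the pairs.\<close>
  have par: "fst l *\<^sub>R m = fst m *\<^sub>R l"
    using col unfolding eqs by (intro prod_eqI) auto
  have "J (fst l *\<^sub>R m) = J (fst m *\<^sub>R l)" by (simp add: par)
  then have "fst l *\<^sub>R J l = fst m *\<^sub>R J l" using J(1) by (simp add: linear_cmul[OF lin])
  then have fe: "fst l = fst m" using J(2) by simp
  show False
  proof (cases "fst l = 0")
    case True
    then have "l = 0" using eqs by (intro prod_eqI) auto
    then show False using J(2) linear_0[OF lin] by simp
  next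
    case False
    then show False using par fe ne by simp
  qed
qed

section \<open>Strict second-order expansions\<close>

lemma norm_matrix_vector_mult_le:
  fixes A :: "real^'n^'m"
  shows "norm (A *v x) \<le> norm A * norm x"
proof -
  have "norm (A *v x) \<le> L2_set (\<lambda>i. norm (A $ i) * norm x) UNIV"
    unfolding norm_vec_def[of "A *v x"]
    by (intro L2_set_mono) (auto simp: matrix_vector_mul_component Cauchy_Schwarz_ineq2)
  also have "\<dots> = norm A * norm x"
    by (simp add: norm_vec_def[of A] L2_set_left_distrib)
  finally show ?thesis .
qed

text \<open>Both points move while the Hessian is frozen at \<open>xb\<close>, because the later
  sequences approach \<open>xb\<close> at rates unrelated to their mutual distance. This is the mean
  value inequality for \<open>h'\<close> minus its linear part, whose derivative is small near
  \<open>xb\<close> by continuity of \<open>h''\<close>.\<close>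

lemma C2_strict_gradient:
  assumes "C2_around h h' h'' xb" "e > 0"
  shows "\<exists>d>0. \<forall>x\<in>ball xb d. \<forall>y\<in>ball xb d. norm (h' y - h' x - h'' xb *v (y - x)) \<le> e * norm (y - x)"
proof -
  obtain U where U: "open U" "xb \<in> U"
    and h': "\<And>x. x \<in> U \<Longrightarrow> (h' has_derivative (\<lambda>v. h'' x *v v)) (at x)"
    and cont: "continuous_on U h''"
    using assms(1) unfolding C2_around_def by blast
  have "(h'' \<longlongrightarrow> h'' xb) (at xb)"
    using cont U by (simp add: continuous_on_eq_continuous_at isCont_def)
  then have "\<forall>\<^sub>F x in nhds xb. dist (h'' x) (h'' xb) < e"
    using \<open>e > 0\<close> unfolding tendsto_at_iff_tendsto_nhds by (rule tendstoD)
  then have "\<forall>\<^sub>F x in nhds xb. onorm (\<lambda>v. (h'' x - h'' xb) *v v) \<le> e"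
  proof eventually_elim
    case (elim x)
    show ?case
    proof (rule onorm_bound)
      fix v
      have "norm ((h'' x - h'' xb) *v v) \<le> norm (h'' x - h'' xb) * norm v"
        by (rule norm_matrix_vector_mult_le)
      also have "\<dots> \<le> e * norm v"
        using elim by (intro mult_right_mono) (auto simp: dist_norm)
      finally show "norm ((h'' x - h'' xb) *v v) \<le> e * norm v" .
    qed (use \<open>e > 0\<close> in simp)
  qed
  then obtain d1 where d1: "d1 > 0" "\<And>x. x \<in> ball xb d1 \<Longrightarrow> onorm (\<lambda>v. (h'' x - h'' xb) *v v) \<le> e"
    unfolding eventually_nhds_metric by (auto simp: dist_commute)
  obtain d2 where d2: "d2 > 0" "ball xb d2 \<subseteq> U" using U open_contains_ball by blast
  define d where "d = min d1 d2"
  have "norm (h' y - h' x - h'' xb *v (y - x)) \<le> e * norm (y - x)"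
    if "x \<in> ball xb d" "y \<in> ball xb d" for x y
  proof -
    have "norm ((h' y - h'' xb *v y) - (h' x - h'' xb *v x)) \<le> e * norm (y - x)"
    proof (rule differentiable_bound[of "ball xb d" _ "\<lambda>z v. (h'' z - h'' xb) *v v"])
      fix z assume z: "z \<in> ball xb d"
      then have "z \<in> U" using d2 by (auto simp: d_def)
      have "((\<lambda>z. h' z - h'' xb *v z) has_derivative (\<lambda>v. h'' z *v v - h'' xb *v v)) (at z within ball xb d)"
        by (intro has_derivative_diff has_derivative_at_withinI[OF h'[OF \<open>z \<in> U\<close>]]
            bounded_linear_imp_has_derivative matrix_vector_mul_bounded_linear)
      then show "((\<lambda>z. h' z - h'' xb *v z) has_derivative (\<lambda>v. (h'' z - h'' xb) *v v)) (at z within ball xb d)"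
        by (simp add: matrix_vector_mult_diff_rdistrib)
      show "onorm (\<lambda>v. (h'' z - h'' xb) *v v) \<le> e" using d1(2) z by (simp add: d_def)
    qed (use that in auto)
    then show ?thesis by (simp add: matrix_vector_mult_diff_distrib algebra_simps)
  qed
  moreover have "d > 0" using d1 d2 by (simp add: d_def)
  ultimately show ?thesis by blast
qed

text \<open>The mean value theorem on the segment is applied to the Taylor remainder
  \<open>\<phi>\<close>, whose derivative is the error controlled by
  \<open>C2_strict_gradient\<close>.\<close>

lemma C2_strict_taylor:
  assumes C2: "C2_around h h' h'' xb" and e: "e > 0"
  shows "\<exists>d>0. \<forall>x\<in>ball xb d. \<forall>y\<in>ball xb d.
    \<bar>h y - h x - h' x \<bullet> (y - x) - ((h'' xb *v (y - x)) \<bullet> (y - x)) / 2\<bar> \<le> e * (norm (y - x))\<^sup>2"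
proof -
  obtain U where U: "open U" "xb \<in> U"
    and h: "\<And>x. x \<in> U \<Longrightarrow> (h has_derivative (\<lambda>v. h' x \<bullet> v)) (at x)"
    using C2 unfolding C2_around_def by blast
  obtain d1 where d1: "d1 > 0"
    "\<And>x y. x \<in> ball xb d1 \<Longrightarrow> y \<in> ball xb d1 \<Longrightarrow> norm (h' y - h' x - h'' xb *v (y - x)) \<le> e * norm (y - x)"
    using C2_strict_gradient[OF C2 e] by blast
  obtain d2 where d2: "d2 > 0" "ball xb d2 \<subseteq> U" using U open_contains_ball by blast
  define d where "d = min d1 d2"
  have "\<bar>h y - h x - h' x \<bullet> (y - x) - ((h'' xb *v (y - x)) \<bullet> (y - x)) / 2\<bar> \<le> e * (norm (y - x))\<^sup>2"
    if xy: "x \<in> ball xb d" "y \<in> ball xb d" for x y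
  proof -
    define w where "w = y - x"
    define H where "H = (h'' xb *v w) \<bullet> w"
    define \<phi> where "\<phi> s = h (x + s *\<^sub>R w) - s * (h' x \<bullet> w) - s\<^sup>2 * H / 2" for s
    have seg: "x + s *\<^sub>R w \<in> ball xb d" if "0 \<le> s" "s \<le> 1" for s
    proof -
      have "(1 - s) *\<^sub>R x + s *\<^sub>R y \<in> ball xb d"
        using xy that by (intro convexD[OF convex_ball]) auto
      then show ?thesis by (simp add: w_def algebra_simps)
    qed
    have der: "(\<phi> has_real_derivative (h' (x + s *\<^sub>R w) - h' x - h'' xb *v (s *\<^sub>R w)) \<bullet> w) (at s)"
      if "0 \<le> s" "s \<le> 1" for s
    proof -
      have U': "x + s *\<^sub>R w \<in> U" using seg[OF that] d2(2) by (auto simp: d_def)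
      have "((\<lambda>s. x + s *\<^sub>R w) has_derivative (\<lambda>s. s *\<^sub>R w)) (at s)"
        by (auto intro!: derivative_eq_intros)
      from has_derivative_compose[OF this h[OF U']]
      have "((\<lambda>s. h (x + s *\<^sub>R w)) has_real_derivative (h' (x + s *\<^sub>R w) \<bullet> w)) (at s)"
        unfolding has_field_derivative_def inner_scaleR_right
        by (rule has_derivative_eq_rhs) (simp add: fun_eq_iff)
      then have "(\<phi> has_real_derivative (h' (x + s *\<^sub>R w) \<bullet> w - h' x \<bullet> w - s * H)) (at s)"
        unfolding \<phi>_def by (auto intro!: derivative_eq_intros)
      then show ?thesis
        by (simp add: H_def inner_diff_left matrix_vector_mult_scaleR)
    qed
    obtain s where s: "0 < s" "s < 1"
      "\<phi> 1 - \<phi> 0 = (1 - 0) * ((h' (x + s *\<^sub>R w) - h' x - h'' xb *v (s *\<^sub>R w)) \<bullet> w)"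
      using MVT2[of 0 1 \<phi> "\<lambda>s. (h' (x + s *\<^sub>R w) - h' x - h'' xb *v (s *\<^sub>R w)) \<bullet> w"] der by auto
    have "\<bar>\<phi> 1 - \<phi> 0\<bar> \<le> norm (h' (x + s *\<^sub>R w) - h' x - h'' xb *v (s *\<^sub>R w)) * norm w"
      using s(3) Cauchy_Schwarz_ineq2 by simp
    also have "\<dots> \<le> (e * norm w) * norm w"
    proof (intro mult_right_mono)
      have "norm (h' (x + s *\<^sub>R w) - h' x - h'' xb *v (s *\<^sub>R w)) \<le> e * norm (s *\<^sub>R w)"
        using d1(2)[of x "x + s *\<^sub>R w"] seg[of s] s xy(1) by (simp add: d_def)
      also have "\<dots> \<le> e * norm w" using s e by (simp add: mult_left_le_one_le)
      finally show "norm (h' (x + s *\<^sub>R w) - h' x - h'' xb *v (s *\<^sub>R w)) \<le> e * norm w" .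
    qed auto
    finally show ?thesis
      by (simp add: \<phi>_def w_def H_def power2_eq_square algebra_simps)
  qed
  moreover have "d > 0" using d1 d2 by (simp add: d_def)
  ultimately show ?thesis by blast
qed

text \<open>The linear term is taken at the moving base \<open>x k\<close>, which is where the
  multiplier equation holds later on; the quadratic term still converges to the Hessian at
  \<open>xb\<close>.\<close>

lemma C2_quotient_second_order:
  assumes C2: "C2_around h h' h'' xb" and x: "x \<longlonglongrightarrow> xb" and y: "y \<longlonglongrightarrow> xb"
    and ne: "\<And>k. x k \<noteq> y k" and w: "(\<lambda>k. sgn (y k - x k)) \<longlonglongrightarrow> w"
  shows "(\<lambda>k. (h (y k) - h (x k) - h' (x k) \<bullet> (y k - x k)) / (norm (y k - x k))\<^sup>2)
           \<longlonglongrightarrow> (h'' xb *v w) \<bullet> w / 2"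
proof -
  let ?q = "\<lambda>k. (h (y k) - h (x k) - h' (x k) \<bullet> (y k - x k)) / (norm (y k - x k))\<^sup>2"
  let ?s = "\<lambda>k. (h'' xb *v sgn (y k - x k)) \<bullet> sgn (y k - x k) / 2"
  have "(\<lambda>k. ?q k - ?s k) \<longlonglongrightarrow> 0"
  proof (rule LIMSEQ_I)
    fix e :: real assume "e > 0"
    then obtain d where d: "d > 0" "\<And>x y. x \<in> ball xb d \<Longrightarrow> y \<in> ball xb d \<Longrightarrow>
      \<bar>h y - h x - h' x \<bullet> (y - x) - ((h'' xb *v (y - x)) \<bullet> (y - x)) / 2\<bar> \<le> e / 2 * (norm (y - x))\<^sup>2"
      using C2_strict_taylor[OF C2, of "e / 2"] by auto
    have "\<forall>\<^sub>F k in sequentially. dist (x k) xb < d \<and> dist (y k) xb < d"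
      using tendstoD[OF x d(1)] tendstoD[OF y d(1)] by eventually_elim simp
    then have "\<forall>\<^sub>F k in sequentially. norm (?q k - ?s k - 0) < e"
    proof eventually_elim
      case (elim k)
      define n where "n = norm (y k - x k)"
      have n: "n > 0" using ne[of k] by (simp add: n_def)
      have "?q k - ?s k = (h (y k) - h (x k) - h' (x k) \<bullet> (y k - x k)
          - ((h'' xb *v (y k - x k)) \<bullet> (y k - x k)) / 2) / n\<^sup>2"
        using n by (simp add: sgn_div_norm matrix_vector_mult_scaleR flip: n_def)
          (simp add: field_simps power2_eq_square)
      moreover have "norm \<dots> \<le> e / 2"
        using d(2)[of "x k" "y k"] elim n by (simp add: dist_commute n_def[symmetric] pos_divide_le_eq)
      ultimately show ?case using \<open>e > 0\<close> by (simp only: diff_0_right)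
    qed
    then show "\<exists>N. \<forall>k\<ge>N. norm (?q k - ?s k - 0) < e" by (simp add: eventually_sequentially)
  qed
  moreover have "?s \<longlonglongrightarrow> (h'' xb *v w) \<bullet> w / 2"
    by (intro tendsto_intros bounded_linear.tendsto[OF matrix_vector_mul_bounded_linear] w) simp
  ultimately show ?thesis using tendsto_add by fastforce
qed

lemma C2_quotient_gradient:
  assumes C2: "C2_around h h' h'' xb" and x: "x \<longlonglongrightarrow> xb" and y: "y \<longlonglongrightarrow> xb"
    and ne: "\<And>k. x k \<noteq> y k" and w: "(\<lambda>k. sgn (y k - x k)) \<longlonglongrightarrow> w"
  shows "(\<lambda>k. ((h' (y k) - h' (x k)) \<bullet> (y k - x k)) / (norm (y k - x k))\<^sup>2) \<longlonglongrightarrow> (h'' xb *v w) \<bullet> w"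
proof -
  let ?q = "\<lambda>k. (h' (y k) - h' (x k)) /\<^sub>R norm (y k - x k)"
  let ?s = "\<lambda>k. h'' xb *v sgn (y k - x k)"
  have "(\<lambda>k. ?q k - ?s k) \<longlonglongrightarrow> 0"
  proof (rule LIMSEQ_I)
    fix e :: real assume "e > 0"
    then obtain d where d: "d > 0" "\<And>x y. x \<in> ball xb d \<Longrightarrow> y \<in> ball xb d \<Longrightarrow>
      norm (h' y - h' x - h'' xb *v (y - x)) \<le> e / 2 * norm (y - x)"
      using C2_strict_gradient[OF C2, of "e / 2"] by auto
    have "\<forall>\<^sub>F k in sequentially. dist (x k) xb < d \<and> dist (y k) xb < d"
      using tendstoD[OF x d(1)] tendstoD[OF y d(1)] by eventually_elim simp
    then have "\<forall>\<^sub>F k in sequentially. norm (?q k - ?s k - 0) < e"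
    proof eventually_elim
      case (elim k)
      define n where "n = norm (y k - x k)"
      have n: "n > 0" using ne[of k] by (simp add: n_def)
      have "?q k - ?s k = (h' (y k) - h' (x k) - h'' xb *v (y k - x k)) /\<^sub>R n"
        unfolding sgn_div_norm n_def[symmetric] matrix_vector_mult_scaleR
        by (simp only: scaleR_diff_right)
      moreover have "norm \<dots> \<le> e / 2"
        using d(2)[of "x k" "y k"] elim n unfolding norm_scaleR
        by (simp add: dist_commute n_def[symmetric] divide_inverse[symmetric] mult.commute[of "inverse n"])
          (simp add: field_simps)
      ultimately show ?case using \<open>e > 0\<close> by simp
    qed
    then show "\<exists>N. \<forall>k\<ge>N. norm (?q k - ?s k - 0) < e" by (simp add: eventually_sequentially)
  qed
  moreover have "?s \<longlonglongrightarrow> h'' xb *v w"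
    by (intro bounded_linear.tendsto[OF matrix_vector_mul_bounded_linear] w)
  ultimately have "?q \<longlonglongrightarrow> h'' xb *v w" using tendsto_add by fastforce
  then have "(\<lambda>k. ?q k \<bullet> sgn (y k - x k)) \<longlonglongrightarrow> (h'' xb *v w) \<bullet> w" by (intro tendsto_inner w)
  then show ?thesis by (simp add: sgn_div_norm divide_inverse power2_eq_square mult_ac)
qed

lemma C2_gradient_tendsto:
  assumes C2: "C2_around h h' h'' xb" and x: "x \<longlonglongrightarrow> xb"
  shows "(\<lambda>k. h' (x k)) \<longlonglongrightarrow> h' xb"
proof -
  have "(h' has_derivative (\<lambda>v. h'' xb *v v)) (at xb)" using C2 unfolding C2_around_def by blast
  then show ?thesis by (rule isCont_tendsto_compose[OF has_derivative_continuous x])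
qed

lemma C2_quotient_first_order:
  assumes C2: "C2_around h h' h'' xb" and x: "x \<longlonglongrightarrow> xb" and y: "y \<longlonglongrightarrow> xb"
    and ne: "\<And>k. x k \<noteq> y k" and w: "(\<lambda>k. sgn (y k - x k)) \<longlonglongrightarrow> w"
  shows "(\<lambda>k. (h (y k) - h (x k)) / norm (y k - x k)) \<longlonglongrightarrow> h' xb \<bullet> w"
proof -
  have n0: "(\<lambda>k. norm (y k - x k)) \<longlonglongrightarrow> 0"
    using tendsto_norm[OF tendsto_diff[OF y x]] by simp
  have "(\<lambda>k. (h (y k) - h (x k) - h' (x k) \<bullet> (y k - x k)) / (norm (y k - x k))\<^sup>2 * norm (y k - x k)
      + h' (x k) \<bullet> sgn (y k - x k)) \<longlonglongrightarrow> (h'' xb *v w) \<bullet> w / 2 * 0 + h' xb \<bullet> w"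
    by (intro tendsto_add tendsto_mult tendsto_inner n0 w C2_quotient_second_order
        C2_gradient_tendsto[OF C2 x] assms)
  moreover have "(h (y k) - h (x k) - h' (x k) \<bullet> (y k - x k)) / (norm (y k - x k))\<^sup>2 * norm (y k - x k)
      + h' (x k) \<bullet> sgn (y k - x k) = (h (y k) - h (x k)) / norm (y k - x k)" for k
  proof -
    define n where "n = norm (y k - x k)"
    have "n \<noteq> 0" using ne[of k] by (simp add: n_def)
    then show ?thesis
      unfolding sgn_div_norm n_def[symmetric] inner_scaleR_right
      by (simp add: power2_eq_square field_simps)
  qed
  ultimately show ?thesis by simp
qed

section \<open>Limits of multipliers at the vertex\<close>

locale soc_program =
  fixes f :: "real^'n \<Rightarrow> real" and f' :: "real^'n \<Rightarrow> real^'n" and f'' :: "real^'n \<Rightarrow> real^'n^'n"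
    and g0 :: "real^'n \<Rightarrow> real" and g0' :: "real^'n \<Rightarrow> real^'n" and g0'' :: "real^'n \<Rightarrow> real^'n^'n"
    and gr :: "real^'n \<Rightarrow> real^'m" and gr' :: "real^'n \<Rightarrow> real^'n^'m"
    and gr'' :: "real^'n \<Rightarrow> 'm \<Rightarrow> real^'n^'n"
    and xb :: "real^'n"
  assumes f_C2: "C2_around f f' f'' xb"
    and g0_C2: "C2_around g0 g0' g0'' xb"
    and gr_C2: "\<And>i. C2_around (\<lambda>x. gr x $ i) (\<lambda>x. gr' x $ i) (\<lambda>x. gr'' x i) xb"
    and g_xb: "g0 xb = 0" "gr xb = 0"
begin

definition G :: "real^'n \<Rightarrow> real \<times> (real^'m)" where
  "G x = (g0 x, gr x)"

definition DG :: "real^'n \<Rightarrow> real^'n \<Rightarrow> real \<times> (real^'m)" where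
  "DG x u = (g0' x \<bullet> u, gr' x *v u)"

definition D2G :: "real^'n \<Rightarrow> real \<times> (real^'m)" where
  "D2G u = ((g0'' xb *v u) \<bullet> u, \<chi> i. (gr'' xb i *v u) \<bullet> u)"

abbreviation Gam :: "(real^'n) set" where
  "Gam \<equiv> {x. G x \<in> soc}"

lemma G_xb [simp]: "G xb = 0"
  by (simp add: G_def g_xb zero_prod_def)

lemma jacT_inner: "jacT g0' gr' x l \<bullet> u = l \<bullet> DG x u"
  by (simp add: jacT_def DG_def inner_prod_def inner_add_left dot_lmul_matrix)

lemma linear_jacT: "linear (jacT g0' gr' x)"
  unfolding jacT_def
  by (rule linearI) (simp_all add: scaleR_add_left vector_matrix_left_distrib scaleR_add_right
      scaleR_vector_matrix_assoc)

lemma linear_DG: "linear (DG x)"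
  unfolding DG_def
  by (rule linearI) (simp_all add: inner_add_right matrix_vector_right_distrib matrix_vector_mult_scaleR)

lemma hess_mult_inner: "(hess_mult g0'' gr'' xb l *v u) \<bullet> u = l \<bullet> D2G u"
proof -
  have "(\<Sum>i\<in>I. c i *\<^sub>R M i) *v u = (\<Sum>i\<in>I. c i *\<^sub>R (M i *v u))"
    for I and c :: "'m \<Rightarrow> real" and M :: "'m \<Rightarrow> real^'n^'n"
    by (induction I rule: infinite_finite_induct)
      (simp_all add: matrix_vector_mult_add_rdistrib scaleR_matrix_vector_assoc)
  then show ?thesis
    by (simp add: hess_mult_def D2G_def inner_prod_def inner_vec_def[of "snd l"] inner_add_left inner_sum_left
        matrix_vector_mult_add_rdistrib flip: scaleR_matrix_vector_assoc)
qed

lemma D2G_uminus: "D2G (- u) = D2G u"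
proof -
  have "A *v (- u) = - (A *v u)" for A :: "real^'n^'n"
    using matrix_vector_mult_scaleR[of A "- 1" u] by simp
  then show ?thesis by (simp add: D2G_def)
qed

lemma DG_uminus: "DG x (- u) = - DG x u"
  by (rule linear_neg[OF linear_DG])

lemma G_second_order:
  assumes "x \<longlonglongrightarrow> xb" "y \<longlonglongrightarrow> xb" "\<And>k. x k \<noteq> y k" "(\<lambda>k. sgn (y k - x k)) \<longlonglongrightarrow> w"
  shows "(\<lambda>k. (G (y k) - G (x k) - DG (x k) (y k - x k)) /\<^sub>R (norm (y k - x k))\<^sup>2) \<longlonglongrightarrow> D2G w /\<^sub>R 2"
proof -
  have "(\<lambda>k. ((g0 (y k) - g0 (x k) - g0' (x k) \<bullet> (y k - x k)) / (norm (y k - x k))\<^sup>2,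
      (gr (y k) - gr (x k) - gr' (x k) *v (y k - x k)) /\<^sub>R (norm (y k - x k))\<^sup>2))
      \<longlonglongrightarrow> ((g0'' xb *v w) \<bullet> w / 2, (\<chi> i. (gr'' xb i *v w) \<bullet> w / 2))"
  proof (intro tendsto_Pair C2_quotient_second_order[OF g0_C2 assms] vec_tendstoI)
    fix i
    show "(\<lambda>k. ((gr (y k) - gr (x k) - gr' (x k) *v (y k - x k)) /\<^sub>R (norm (y k - x k))\<^sup>2) $ i)
      \<longlonglongrightarrow> (\<chi> i. (gr'' xb i *v w) \<bullet> w / 2) $ i"
      using C2_quotient_second_order[OF gr_C2 assms, of i]
      by (simp only: matrix_vector_mul_component divide_inverse_commute vector_scaleR_component
          vector_minus_component vec_lambda_beta real_scaleR_def)
  qed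
  moreover have "((g0 (y k) - g0 (x k) - g0' (x k) \<bullet> (y k - x k)) / (norm (y k - x k))\<^sup>2,
      (gr (y k) - gr (x k) - gr' (x k) *v (y k - x k)) /\<^sub>R (norm (y k - x k))\<^sup>2)
      = (G (y k) - G (x k) - DG (x k) (y k - x k)) /\<^sub>R (norm (y k - x k))\<^sup>2" for k
    by (simp only: G_def DG_def diff_Pair scaleR_Pair divide_inverse_commute real_scaleR_def)
  moreover have "((g0'' xb *v w) \<bullet> w / 2, (\<chi> i. (gr'' xb i *v w) \<bullet> w / 2)) = D2G w /\<^sub>R 2"
    by (simp add: D2G_def vec_eq_iff)
  ultimately show ?thesis by (simp only:)
qed

lemma G_first_order:
  assumes "x \<longlonglongrightarrow> xb" "y \<longlonglongrightarrow> xb" "\<And>k. x k \<noteq> y k" "(\<lambda>k. sgn (y k - x k)) \<longlonglongrightarrow> w"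
  shows "(\<lambda>k. (G (y k) - G (x k)) /\<^sub>R norm (y k - x k)) \<longlonglongrightarrow> DG xb w"
proof -
  have "(\<lambda>k. ((g0 (y k) - g0 (x k)) / norm (y k - x k), (gr (y k) - gr (x k)) /\<^sub>R norm (y k - x k)))
      \<longlonglongrightarrow> (g0' xb \<bullet> w, gr' xb *v w)"
  proof (intro tendsto_Pair C2_quotient_first_order[OF g0_C2 assms] vec_tendstoI)
    fix i
    show "(\<lambda>k. ((gr (y k) - gr (x k)) /\<^sub>R norm (y k - x k)) $ i) \<longlonglongrightarrow> (gr' xb *v w) $ i"
      using C2_quotient_first_order[OF gr_C2 assms, of i]
      by (simp only: matrix_vector_mul_component divide_inverse_commute vector_scaleR_component
          vector_minus_component real_scaleR_def)
  qed
  moreover have "((g0 (y k) - g0 (x k)) / norm (y k - x k), (gr (y k) - gr (x k)) /\<^sub>R norm (y k - x k))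
      = (G (y k) - G (x k)) /\<^sub>R norm (y k - x k)" for k
    by (simp only: G_def diff_Pair scaleR_Pair divide_inverse_commute real_scaleR_def)
  ultimately show ?thesis by (simp only: DG_def)
qed

lemma jacT_tendsto:
  assumes x: "x \<longlonglongrightarrow> xb" and l: "l \<longlonglongrightarrow> L"
  shows "(\<lambda>k. jacT g0' gr' (x k) (l k)) \<longlonglongrightarrow> jacT g0' gr' xb L"
proof -
  have gr': "(\<lambda>k. gr' (x k) $ i $ j) \<longlonglongrightarrow> gr' xb $ i $ j" for i j
    using C2_gradient_tendsto[OF gr_C2 x, of i] by (rule tendsto_vec_nth)
  have "(\<lambda>k. snd (l k) v* gr' (x k)) \<longlonglongrightarrow> snd L v* gr' xb"
    by (rule vec_tendstoI) (auto simp: vector_matrix_mult_def intro!: tendsto_intros gr' l)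
  then show ?thesis
    unfolding jacT_def by (intro tendsto_add tendsto_scaleR tendsto_fst l C2_gradient_tendsto[OF g0_C2 x])
qed

lemma G_has_derivative: "\<forall>\<^sub>F x in nhds xb. (G has_derivative DG x) (at x)"
proof -
  have *: "\<forall>\<^sub>F x in nhds xb. (h has_derivative (\<lambda>v. h' x \<bullet> v)) (at x)"
    if "C2_around h h' h'' xb" for h h' h''
    using that unfolding C2_around_def eventually_nhds by blast
  have "\<forall>\<^sub>F x in nhds xb. \<forall>i. ((\<lambda>x. gr x $ i) has_derivative (\<lambda>v. gr' x $ i \<bullet> v)) (at x)"
    by (intro eventually_all_finite *[OF gr_C2])
  with *[OF g0_C2] show ?thesis
  proof eventually_elim
    case (elim x)
    have "(gr has_derivative (\<lambda>u. gr' x *v u)) (at x)"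
      unfolding has_derivative_componentwise_within[of gr]
      using elim(2) by (auto simp: Basis_vec_def inner_axis matrix_vector_mul_component)
    with elim(1) have "((\<lambda>x. (g0 x, gr x)) has_derivative (\<lambda>u. (g0' x \<bullet> u, gr' x *v u))) (at x)"
      by (rule has_derivative_Pair)
    then show ?case by (simp add: G_def[abs_def] DG_def[abs_def])
  qed
qed

lemma f_has_derivative: "\<forall>\<^sub>F x in nhds xb. (f has_derivative (\<lambda>v. f' x \<bullet> v)) (at x)"
  using f_C2 unfolding C2_around_def eventually_nhds by blast

lemma mult_set_xb: "mult_set g0 gr g0' gr' xb xs = {l \<in> soc_polar. jacT g0' gr' xb l = xs}"
  by (simp add: mult_set_def soc_normal_def g_xb zero_prod_def)

lemma dir_mult_set_xb:
  "dir_mult_set g0 gr g0' gr' g0'' gr'' xb xs u =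
    {l \<in> mult_set g0 gr g0' gr' xb xs. \<forall>m \<in> mult_set g0 gr g0' gr' xb xs. m \<bullet> D2G u \<le> l \<bullet> D2G u}"
  by (simp add: dir_mult_set_def curv_def g_xb zero_prod_def hess_mult_inner)

text \<open>For a competitor \<open>n\<close> in the fibre of \<open>L\<close>, the difference
  \<open>n - L\<close> annihilates the range of \<open>DG xb\<close>, so the sign of
  \<open>(n - L) \<bullet> G (x k)\<close> is decided at second order. That product is nonpositive
  as soon as \<open>n + (l k - L)\<close> is polar, since \<open>l k\<close> is complementary to
  \<open>G (x k)\<close>.\<close>

lemma directional_multiplier_limit:
  assumes x: "x \<longlonglongrightarrow> xb" "\<And>k. x k \<in> Gam" "\<And>k. x k \<noteq> xb" and v: "(\<lambda>k. sgn (x k - xb)) \<longlonglongrightarrow> v"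
    and l: "l \<longlonglongrightarrow> L" "\<And>k. l k \<in> soc_polar" "\<And>k. l k \<bullet> G (x k) = 0"
    and L0: "jacT g0' gr' xb L = 0 \<Longrightarrow> L = 0"
  shows "v \<in> critical_cone Gam xb (jacT g0' gr' xb L) \<inter> sphere 0 1"
    and "L \<in> dir_mult_set g0 gr g0' gr' g0'' gr'' xb (jacT g0' gr' xb L) v"
    and "DG xb v \<in> soc" and "L \<bullet> DG xb v = 0"
proof -
  let ?xs = "jacT g0' gr' xb L"
  have nz: "norm (x k - xb) > 0" for k using x(3) by simp
  have lim: "(\<lambda>k. G (x k) /\<^sub>R norm (x k - xb)) \<longlonglongrightarrow> DG xb v"
    using G_first_order[OF tendsto_const x(1) _ v] x(3) by (simp add: not_sym)
  show "DG xb v \<in> soc"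
    using x(2) by (intro closed_sequentially[OF closed_soc _ lim]) (auto intro!: soc_scaleR)
  have L: "L \<in> soc_polar" using closed_sequentially[OF closed_soc_polar l(2,1)] .
  have "(\<lambda>k. l k \<bullet> (G (x k) /\<^sub>R norm (x k - xb))) \<longlonglongrightarrow> L \<bullet> DG xb v"
    by (intro tendsto_inner l lim)
  then show comp: "L \<bullet> DG xb v = 0" using l(3) by (simp add: LIMSEQ_const_iff)
  have "norm v = 1"
    using tendsto_norm[OF v] x(3) by (simp add: norm_sgn LIMSEQ_const_iff)
  moreover have "v \<in> tangent_cone Gam xb"
    unfolding tangent_cone_def
  proof (intro CollectI exI conjI allI)
    show "(\<lambda>k. norm (x k - xb)) \<longlonglongrightarrow> 0"
      using tendsto_norm[OF tendsto_diff[OF x(1) tendsto_const[of xb]]] by simp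
    show "G (xb + norm (x k - xb) *\<^sub>R sgn (x k - xb)) \<in> soc" for k
      using x(2,3) by (simp add: sgn_div_norm)
  qed (use v nz in auto)
  ultimately show "v \<in> critical_cone Gam xb ?xs \<inter> sphere 0 1"
    using comp by (simp add: critical_cone_def jacT_inner)
  have good: "n \<bullet> D2G v \<le> L \<bullet> D2G v"
    if n: "jacT g0' gr' xb n = ?xs" and ev: "\<forall>\<^sub>F k in sequentially. n + (l k - L) \<in> soc_polar" for n
  proof -
    have "(\<lambda>k. (n - L) \<bullet> ((G (x k) - G xb - DG xb (x k - xb)) /\<^sub>R (norm (x k - xb))\<^sup>2))
        \<longlonglongrightarrow> (n - L) \<bullet> (D2G v /\<^sub>R 2)"
      using G_second_order[OF tendsto_const x(1) _ v] x(3) by (intro tendsto_inner tendsto_const) (simp add: not_sym)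
    moreover have "(n - L) \<bullet> DG xb u = 0" for u
    proof -
      have "(n - L) \<bullet> DG xb u = jacT g0' gr' xb n \<bullet> u - jacT g0' gr' xb L \<bullet> u"
        by (simp only: jacT_inner inner_diff_left)
      then show ?thesis by (simp add: n)
    qed
    then have "(n - L) \<bullet> ((G (x k) - G xb - DG xb (x k - xb)) /\<^sub>R (norm (x k - xb))\<^sup>2)
        = ((n - L) \<bullet> G (x k)) / (norm (x k - xb))\<^sup>2" for k
      by (simp only: inner_scaleR_right inner_diff_right[of "n - L"] G_xb inner_zero_right diff_0_right
          divide_inverse_commute)
    ultimately have "(\<lambda>k. ((n - L) \<bullet> G (x k)) / (norm (x k - xb))\<^sup>2) \<longlonglongrightarrow> (n - L) \<bullet> (D2G v /\<^sub>R 2)"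
      by (simp only:)
    moreover have "\<forall>\<^sub>F k in sequentially. ((n - L) \<bullet> G (x k)) / (norm (x k - xb))\<^sup>2 \<le> 0"
      using ev
    proof eventually_elim
      case (elim k)
      have "(n + (l k - L)) \<bullet> G (x k) \<le> 0" using soc_polar_inner_nonpos[OF elim] x(2) by simp
      then have "(n - L) \<bullet> G (x k) \<le> 0" using l(3)[of k] by (simp add: inner_add_left inner_diff_left)
      then show ?case by (simp add: divide_nonpos_nonneg)
    qed
    ultimately have "(n - L) \<bullet> (D2G v /\<^sub>R 2) \<le> 0"
      using tendsto_upperbound sequentially_bot by blast
    then show ?thesis by (simp add: inner_diff_left)
  qed
  have "m \<bullet> D2G v \<le> L \<bullet> D2G v" if m: "m \<in> soc_polar" "jacT g0' gr' xb m = ?xs" for m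
  proof (cases "?xs = 0 \<or> m = L")
    case True
    then show ?thesis
    proof
      \<comment> \<open>The fibre is now a cone, and a midpoint may stay on its boundary. But
        \<open>L = 0\<close>, so \<open>m + l k\<close> is polar because the polar cone is closed
        under addition.\<close>
      assume "?xs = 0"
      then have "L = 0" by (rule L0)
      then show ?thesis using m l(2) by (intro good) (auto intro!: always_eventually soc_polar_add)
    qed simp
  next
    case False
    \<comment> \<open>The midpoint is interior, hence polar after the perturbation
      \<open>l k - L\<close>; the objective is linear, so the comparison of \<open>n\<close> with
      \<open>L\<close> carries over to \<open>m\<close>. The form \<open>1 - 1/2\<close> matches
      \<open>soc_polar_strict_convex\<close>.\<close>
    define n where "n = (1 - 1/2) *\<^sub>R L + (1/2) *\<^sub>R m"
    have int: "norm (snd n) < - fst n"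
      unfolding n_def using False m by (intro soc_polar_strict_convex[OF L m(1) _ _ linear_jacT]) auto
    have Jn: "jacT g0' gr' xb n = ?xs"
      using m(2) unfolding n_def linear_add[OF linear_jacT] linear_cmul[OF linear_jacT]
      by (simp flip: scaleR_add_left)
    have "(\<lambda>k. norm (snd (n + (l k - L))) + fst (n + (l k - L))) \<longlonglongrightarrow> norm (snd (n + (L - L))) + fst (n + (L - L))"
      by (intro tendsto_intros l)
    then have "\<forall>\<^sub>F k in sequentially. norm (snd (n + (l k - L))) + fst (n + (l k - L)) < 0"
      by (rule order_tendstoD) (use int in simp)
    then have "\<forall>\<^sub>F k in sequentially. n + (l k - L) \<in> soc_polar"
      by eventually_elim (simp add: soc_polar_iff)
    from good[OF Jn this] show ?thesis by (simp add: n_def inner_add_left)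
  qed
  then show "L \<in> dir_mult_set g0 gr g0' gr' g0'' gr'' xb ?xs v"
    using L by (auto simp: dir_mult_set_xb mult_set_xb)
qed

text \<open>The first condition is a squeeze: \<open>l k \<bullet> e k\<close> lies between
  \<open>- (C * n k)\<close> and \<open>0\<close>. For the second, \<open>lorentz_diff_ge\<close>
  bounds \<open>- fst (l k) * lorentz (e k)\<close> below by a multiple of
  \<open>fst (G (x k))\<close>, which tends to \<open>0\<close> because \<open>xb\<close> is mapped
  to the vertex; \<open>lorentz_orthogonal\<close> supplies the opposite sign.\<close>

lemma multiplier_side_conditions:
  assumes x: "x \<longlonglongrightarrow> xb" "y \<longlonglongrightarrow> xb" "\<And>k. x k \<noteq> y k" "(\<lambda>k. sgn (y k - x k)) \<longlonglongrightarrow> w"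
    and feas: "\<And>k. x k \<in> Gam" "\<And>k. y k \<in> Gam"
    and l: "l \<longlonglongrightarrow> L" "\<And>k. l k \<in> soc_polar" "\<And>k. l k \<bullet> G (x k) = 0"
    and bnd: "\<And>k. - (l k \<bullet> G (y k)) \<le> C * (norm (y k - x k))\<^sup>2"
  shows "L \<bullet> DG xb w = 0" "fst L * lorentz (DG xb w) = 0"
proof -
  define n where "n k = norm (y k - x k)" for k
  define e where "e k = (G (y k) - G (x k)) /\<^sub>R n k" for k
  have n: "n k > 0" for k using x(3) by (simp add: n_def not_sym)
  have n0: "n \<longlonglongrightarrow> 0" unfolding n_def using tendsto_norm[OF tendsto_diff[OF x(2,1)]] by simp
  have e: "e \<longlonglongrightarrow> DG xb w" unfolding e_def n_def by (rule G_first_order[OF x])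
  have L: "L \<in> soc_polar" using closed_sequentially[OF closed_soc_polar l(2,1)] .
  have le: "l k \<bullet> e k = (l k \<bullet> G (y k)) / n k" for k
    using l(3)[of k] by (simp add: e_def inner_diff_right divide_inverse mult.commute)
  have le0: "l k \<bullet> e k \<le> 0" for k
    unfolding le using soc_polar_inner_nonpos[OF l(2)] feas(2) n[of k] by (simp add: divide_nonpos_pos)
  have lower: "- (C * n k) \<le> l k \<bullet> e k" for k
    using bnd[of k] n[of k] unfolding le n_def[symmetric] by (simp add: field_simps power2_eq_square)
  have lim: "(\<lambda>k. l k \<bullet> e k) \<longlonglongrightarrow> L \<bullet> DG xb w" by (intro tendsto_inner l e)
  have "(\<lambda>k. - (C * n k)) \<longlonglongrightarrow> - (C * 0)" by (intro tendsto_intros n0)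
  then have "- (C * 0) \<le> L \<bullet> DG xb w"
    by (rule LIMSEQ_le[OF _ lim]) (use lower in blast)
  moreover have "L \<bullet> DG xb w \<le> 0"
    using lim by (rule LIMSEQ_le_const2) (use le0 in blast)
  ultimately show *: "L \<bullet> DG xb w = 0" by simp
  have G0: "(\<lambda>k. fst (G (x k))) \<longlonglongrightarrow> 0"
  proof -
    have "(G \<longlongrightarrow> G xb) (at xb)"
      using has_derivative_continuous eventually_nhds_x_imp_x[OF G_has_derivative] isCont_def by blast
    then have "(\<lambda>k. G (x k)) \<longlonglongrightarrow> G xb"
      using isCont_tendsto_compose[OF _ x(1)] unfolding isCont_def by blast
    from tendsto_fst[OF this] show ?thesis by simp
  qed
  have lower0: "fst (G (x k)) * (- 2 * C) \<le> - fst (l k) * lorentz (e k)" for k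
  proof -
    have e_eq: "lorentz (e k) = lorentz (G (y k) - G (x k)) / (n k)\<^sup>2"
      by (simp add: e_def lorentz_scaleR power_inverse divide_inverse mult.commute)
    have pos: "0 < (n k)\<^sup>2" using n[of k] by simp
    have "fst (G (x k)) * (- 2 * C) * (n k)\<^sup>2 = 2 * fst (G (x k)) * (- C * (n k)\<^sup>2)" by simp
    also have "\<dots> \<le> 2 * fst (G (x k)) * (l k \<bullet> G (y k))"
    proof (rule mult_left_mono)
      show "- C * (n k)\<^sup>2 \<le> l k \<bullet> G (y k)" using bnd[of k] by (simp add: n_def)
      have "norm (snd (G (x k))) \<le> fst (G (x k))" using feas(1)[of k] by (simp add: soc_iff)
      then show "0 \<le> 2 * fst (G (x k))" using norm_ge_zero[of "snd (G (x k))"] by linarith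
    qed
    also have "\<dots> \<le> - fst (l k) * lorentz (G (y k) - G (x k))"
      by (rule lorentz_diff_ge) (use l(2,3)[of k] feas[of k] in simp_all)
    finally have "fst (G (x k)) * (- 2 * C) \<le> - fst (l k) * lorentz (G (y k) - G (x k)) / (n k)\<^sup>2"
      using pos by (rule mult_imp_le_div_pos[rotated])
    then show ?thesis by (simp add: e_eq)
  qed
  have "(\<lambda>k. fst (G (x k)) * (- 2 * C)) \<longlonglongrightarrow> 0 * (- 2 * C)" by (intro tendsto_mult G0 tendsto_const)
  moreover have "(\<lambda>k. - fst (l k) * lorentz (e k)) \<longlonglongrightarrow> - fst L * lorentz (DG xb w)"
    by (intro tendsto_mult tendsto_minus tendsto_fst tendsto_lorentz l e)
  ultimately have "0 * (- 2 * C) \<le> - fst L * lorentz (DG xb w)"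
    by (rule LIMSEQ_le) (use lower0 in blast)
  with lorentz_orthogonal[OF L *] show "fst L * lorentz (DG xb w) = 0" by simp
qed

text \<open>The monotonicity quotient splits exactly into a convergent part \<open>a\<close> and two
  nonnegative complementarity gaps \<open>s\<close> and \<open>t\<close>. Dropping the gaps gives
  the Hessian bound; bounding them by means of \<open>a\<close> gives the side conditions.\<close>

lemma monotonicity_limit:
  assumes x: "x \<longlonglongrightarrow> xb" "y \<longlonglongrightarrow> xb" "\<And>k. x k \<noteq> y k" "(\<lambda>k. sgn (y k - x k)) \<longlonglongrightarrow> w"
    and feas: "\<And>k. x k \<in> Gam" "\<And>k. y k \<in> Gam"
    and l: "l \<longlonglongrightarrow> L" "\<And>k. l k \<in> soc_polar" "\<And>k. l k \<bullet> G (x k) = 0"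
    and m: "m \<longlonglongrightarrow> M" "\<And>k. m k \<in> soc_polar" "\<And>k. m k \<bullet> G (y k) = 0"
    and le: "\<And>k. ((f' (y k) + jacT g0' gr' (y k) (m k)) - (f' (x k) + jacT g0' gr' (x k) (l k))) \<bullet> (y k - x k)
        \<le> c * (norm (y k - x k))\<^sup>2"
  shows "L \<bullet> DG xb w = 0" "fst L * lorentz (DG xb w) = 0" "M \<bullet> DG xb w = 0" "fst M * lorentz (DG xb w) = 0"
    and "(f'' xb *v w) \<bullet> w + (L \<bullet> D2G w + M \<bullet> D2G w) / 2 \<le> c"
proof -
  define n where "n k = norm (y k - x k)" for k
  have n: "n k > 0" for k using x(3) by (simp add: n_def not_sym)
  have yx: "\<And>k. y k \<noteq> x k" using x(3) by metis
  have w': "(\<lambda>k. sgn (x k - y k)) \<longlonglongrightarrow> - w"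
    using tendsto_minus[OF x(4)] by (simp flip: sgn_minus)
  \<comment> \<open>Each multiplier is paired with the expansion at its own point, so that
    \<open>l k\<close> meets \<open>DG (x k)\<close> and \<open>m k\<close> meets
    \<open>DG (y k)\<close>. Each constraint expansion contributes half of \<open>D2G w\<close>,
    whence the average.\<close>
  define a where "a k = (f' (y k) - f' (x k)) \<bullet> (y k - x k) / (n k)\<^sup>2
      + l k \<bullet> ((G (y k) - G (x k) - DG (x k) (y k - x k)) /\<^sub>R (n k)\<^sup>2)
      + m k \<bullet> ((G (x k) - G (y k) - DG (y k) (x k - y k)) /\<^sub>R (norm (x k - y k))\<^sup>2)" for k
  have "a \<longlonglongrightarrow> (f'' xb *v w) \<bullet> w + L \<bullet> (D2G w /\<^sub>R 2) + M \<bullet> (D2G (- w) /\<^sub>R 2)"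
    unfolding a_def n_def
    by (intro tendsto_add tendsto_inner C2_quotient_gradient[OF f_C2 x] l m G_second_order[OF x]
        G_second_order[OF x(2,1) yx w'])
  then have a: "a \<longlonglongrightarrow> (f'' xb *v w) \<bullet> w + (L \<bullet> D2G w + M \<bullet> D2G w) / 2"
    by (simp add: D2G_uminus add_divide_distrib add.assoc)
  define s where "s k = - (l k \<bullet> G (y k)) / (n k)\<^sup>2" for k
  define t where "t k = - (m k \<bullet> G (x k)) / (n k)\<^sup>2" for k
  have s: "0 \<le> s k" and t: "0 \<le> t k" for k
    using soc_polar_inner_nonpos[OF l(2)] soc_polar_inner_nonpos[OF m(2)] feas by (auto simp: s_def t_def divide_nonpos_nonneg)
  have sum: "a k + s k + t k \<le> c" for k
  proof -
    have e: "jacT g0' gr' (x k) (l k) \<bullet> (y k - x k) = l k \<bullet> DG (x k) (y k - x k)"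
       "jacT g0' gr' (y k) (m k) \<bullet> (y k - x k) = - (m k \<bullet> DG (y k) (x k - y k))"
      using DG_uminus[of "y k" "x k - y k"] by (simp_all add: jacT_inner)
    have "a k + s k + t k = (((f' (y k) + jacT g0' gr' (y k) (m k)) - (f' (x k) + jacT g0' gr' (x k) (l k))) \<bullet> (y k - x k)) / (n k)\<^sup>2"
      unfolding a_def s_def t_def n_def norm_minus_commute[of "x k"] inner_scaleR_right inner_diff_left inner_add_left
        inner_diff_right[of "l k"] inner_diff_right[of "m k"] e l(3) m(3)
      by (simp add: divide_inverse algebra_simps)
    also have "\<dots> \<le> c" using le[of k] n[of k] by (simp add: n_def pos_divide_le_eq)
    finally show ?thesis .
  qed
  have "Bseq a" using a by (intro convergent_imp_Bseq convergentI)
  then obtain K where K: "\<And>k. \<bar>a k\<bar> \<le> K" by (metis BseqE real_norm_def)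
  \<comment> \<open>Each gap is at most \<open>c - a k\<close>, since the other one is
    nonnegative.\<close>
  have st: "s k \<le> c + K" "t k \<le> c + K" for k
    using K[of k] s[of k] t[of k] sum[of k] by linarith+
  have "s k * (n k)\<^sup>2 \<le> (c + K) * (n k)\<^sup>2" "t k * (n k)\<^sup>2 \<le> (c + K) * (n k)\<^sup>2" for k
    using st[of k] by (simp_all add: mult_right_mono)
  moreover have "s k * (n k)\<^sup>2 = - (l k \<bullet> G (y k))" "t k * (n k)\<^sup>2 = - (m k \<bullet> G (x k))" for k
    using n[of k] by (simp_all add: s_def t_def)
  ultimately have bnd: "- (l k \<bullet> G (y k)) \<le> (c + K) * (norm (y k - x k))\<^sup>2"
    "- (m k \<bullet> G (x k)) \<le> (c + K) * (norm (x k - y k))\<^sup>2" for k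
    unfolding norm_minus_commute[of "x k" "y k"] n_def[symmetric] by metis+
  \<comment> \<open>The roles of the two points are exchanged for \<open>M\<close>, with direction
    \<open>- w\<close>; both side conditions are insensitive to the sign of the direction.\<close>
  note condL = multiplier_side_conditions[of x y w l L "c + K", OF x feas l bnd(1)]
    and condM = multiplier_side_conditions[of y x "- w" m M "c + K", OF x(2,1) yx w' feas(2,1) m bnd(2)]
  show "L \<bullet> DG xb w = 0" by (rule condL)
  show "fst L * lorentz (DG xb w) = 0" by (rule condL)
  show "M \<bullet> DG xb w = 0" using condM(1) by (simp add: DG_uminus)
  show "fst M * lorentz (DG xb w) = 0" using condM(2) by (simp add: DG_uminus lorentz_def)
  show "(f'' xb *v w) \<bullet> w + (L \<bullet> D2G w + M \<bullet> D2G w) / 2 \<le> c"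
  proof (rule LIMSEQ_le_const2[OF a], intro exI allI impI)
    show "a k \<le> c" for k using sum[of k] s[of k] t[of k] by linarith
  qed
qed

end

section \<open>Strong monotonicity and tilt stability\<close>

lemma local_min_regular_normal:
  fixes h :: "'a::euclidean_space \<Rightarrow> real"
  assumes "x \<in> S" "(h has_derivative (\<lambda>u. p \<bullet> u)) (at x)" "d > 0"
    and min: "\<And>y. y \<in> S \<Longrightarrow> norm (y - x) < d \<Longrightarrow> h x \<le> h y"
  shows "- p \<in> regular_normal S x"
  unfolding regular_normal_def
proof (intro CollectI conjI allI impI)
  fix e :: real assume "e > 0"
  then obtain d' where d': "d' > 0" "\<And>y. norm (y - x) < d' \<Longrightarrow> norm (h y - h x - p \<bullet> (y - x)) \<le> e * norm (y - x)"
    using assms(2) unfolding has_derivative_at_alt by blast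
  show "\<exists>d>0. \<forall>y\<in>S. norm (y - x) < d \<longrightarrow> - p \<bullet> (y - x) \<le> e * norm (y - x)"
  proof (intro exI[of _ "min d d'"] conjI ballI impI)
    fix y assume y: "y \<in> S" "norm (y - x) < min d d'"
    then have "h x \<le> h y" "\<bar>h y - h x - p \<bullet> (y - x)\<bar> \<le> e * norm (y - x)"
      using min d'(2) by auto
    then show "- p \<bullet> (y - x) \<le> e * norm (y - x)" by simp
  qed (use \<open>d > 0\<close> d' in auto)
qed fact

locale soc_program_sosc = soc_program f f' f'' g0 g0' g0'' gr gr' gr'' xb
  for f :: "real^'n \<Rightarrow> real" and f' f'' g0 g0' g0''
    and gr :: "real^'n \<Rightarrow> real^'m" and gr' gr'' xb +
  fixes sgm kappa :: real
  assumes stationary: "- f' xb \<in> limiting_normal {x. (g0 x, gr x) \<in> soc} xb"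
    and sgm_pos: "sgm > 0"
    and mscq: "MSCQ g0 gr xb sgm"
    and kappa_pos: "kappa > 0"
    and SOSC: "\<And>lam u. lam \<in> (\<Union>v \<in> critical_cone {x. (g0 x, gr x) \<in> soc} xb (- f' xb) \<inter> sphere 0 1.
                   dir_mult_set g0 gr g0' gr' g0'' gr'' xb (- f' xb) v) \<Longrightarrow>
               norm u = 1 \<Longrightarrow>
               fst lam * (g0' xb \<bullet> u) + snd lam \<bullet> (gr' xb *v u) = 0 \<Longrightarrow>
               fst lam * ((norm (gr' xb *v u))\<^sup>2 - (g0' xb \<bullet> u)\<^sup>2) = 0 \<Longrightarrow>
               ((f'' xb + hess_mult g0'' gr'' xb lam) *v u) \<bullet> u > 1 / kappa"
begin

section \<open>KKT points of tilted problems and limits of their multipliers\<close>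

text \<open>A tilt may have an unbounded set of multipliers at \<open>x\<close>. The norm bound
  selects some that stay in a compact set and that tend to \<open>0\<close> when
  \<open>f' xb = 0\<close>, as \<open>x\<close> tends to \<open>xb\<close> and the tilt to
  \<open>0\<close>.\<close>

definition KKT :: "real^'n \<Rightarrow> real^'n \<Rightarrow> real \<times> (real^'m) \<Rightarrow> bool" where
  "KKT v x l \<longleftrightarrow> G x \<in> soc \<and> l \<in> soc_polar \<and> l \<bullet> G x = 0 \<and> f' x + jacT g0' gr' x l = v \<and>
     norm l \<le> sgm * norm (jacT g0' gr' x l)"

lemma KKT_gradient: "KKT v x l \<Longrightarrow> jacT g0' gr' x l = v - f' x"
  unfolding KKT_def by auto

lemma KKT_norm: "KKT v x l \<Longrightarrow> norm l \<le> sgm * norm (v - f' x)"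
  using KKT_gradient[of v x l] unfolding KKT_def by auto

lemma sosc_at:
  assumes "v \<in> critical_cone Gam xb (- f' xb) \<inter> sphere 0 1"
    and "L \<in> dir_mult_set g0 gr g0' gr' g0'' gr'' xb (- f' xb) v"
    and "norm u = 1" "L \<bullet> DG xb u = 0" "fst L * lorentz (DG xb u) = 0"
  shows "1 / kappa < (f'' xb *v u) \<bullet> u + L \<bullet> D2G u"
proof -
  have "((f'' xb + hess_mult g0'' gr'' xb L) *v u) \<bullet> u > 1 / kappa"
    using assms by (intro SOSC) (auto simp: G_def DG_def lorentz_def inner_prod_def)
  then show ?thesis by (simp add: matrix_vector_mult_add_rdistrib inner_add_left hess_mult_inner)
qed

text \<open>MSCQ at \<open>xb\<close> is an estimate on an open set, so it serves with the same
  modulus at every feasible point nearby.\<close>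

lemma multiplier_exists:
  "\<forall>\<^sub>F x in nhds xb. \<forall>v\<in>regular_normal Gam x.
     \<exists>l. l \<in> soc_polar \<and> l \<bullet> G x = 0 \<and> jacT g0' gr' x l = v \<and> norm l \<le> sgm * norm v"
proof -
  obtain U where U: "open U" "xb \<in> U"
    and sub: "\<And>x. x \<in> U \<Longrightarrow> infdist x Gam \<le> sgm * infdist (G x) soc"
    using mscq unfolding MSCQ_def G_def by blast
  have "\<forall>\<^sub>F x in nhds xb. x \<in> U" using U by (rule eventually_nhds_in_open)
  with G_has_derivative show ?thesis
  proof eventually_elim
    case (elim x)
    show ?case
    proof
      fix v assume v: "v \<in> regular_normal Gam x"
      obtain l where l: "\<And>p. p \<in> soc \<Longrightarrow> l \<bullet> (p - G x) \<le> 0" "\<And>u. l \<bullet> DG x u = v \<bullet> u"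
        "norm l \<le> sgm * norm v"
        by (rule regular_normal_multiplier[OF closed_soc convex_soc elim(1) U(1) elim(2) sub _ v])
          (use sgm_pos in auto)
      have "G x \<in> soc" using v by (simp add: regular_normal_def)
      from soc_normal_coneD[OF l(1) this] have "l \<in> soc_polar" "l \<bullet> G x = 0" by auto
      moreover have "jacT g0' gr' x l = v"
        using l(2) unfolding jacT_inner[symmetric] by (metis vector_eq_rdot)
      ultimately show "\<exists>l. l \<in> soc_polar \<and> l \<bullet> G x = 0 \<and> jacT g0' gr' x l = v \<and> norm l \<le> sgm * norm v"
        using l(3) by blast
    qed
  qed
qed

lemma KKT_exists:
  "\<forall>\<^sub>F x in nhds xb. \<forall>v. v - f' x \<in> regular_normal Gam x \<longrightarrow> (\<exists>l. KKT v x l)"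
  using multiplier_exists
proof eventually_elim
  case (elim x)
  show ?case
  proof (intro allI impI)
    fix v assume v: "v - f' x \<in> regular_normal Gam x"
    then obtain l where "l \<in> soc_polar" "l \<bullet> G x = 0" "jacT g0' gr' x l = v - f' x"
      "norm l \<le> sgm * norm (v - f' x)" using elim by blast
    moreover have "G x \<in> soc" using v by (simp add: regular_normal_def)
    ultimately have "KKT v x l" by (simp add: KKT_def)
    then show "\<exists>l. KKT v x l" ..
  qed
qed

text \<open>The limiting normal is approximated by regular normals at nearby points, and the bound
  by \<open>sgm\<close> keeps their multipliers from escaping to infinity.\<close>

lemma stationary_multiplier:
  obtains L where "L \<in> soc_polar" "jacT g0' gr' xb L = - f' xb"
proof -
  obtain x v where x: "x \<longlonglongrightarrow> xb" and v: "v \<longlonglongrightarrow> - f' xb" "\<And>k. v k \<in> regular_normal Gam (x k)"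
    using stationary unfolding limiting_normal_def G_def by blast
  have "\<forall>\<^sub>F k in sequentially. \<forall>w\<in>regular_normal Gam (x k).
     \<exists>l. l \<in> soc_polar \<and> l \<bullet> G (x k) = 0 \<and> jacT g0' gr' (x k) l = w \<and> norm l \<le> sgm * norm w"
    using eventually_compose_filterlim[OF multiplier_exists x] .
  then obtain N where "\<forall>k\<ge>N. \<exists>l. l \<in> soc_polar \<and> jacT g0' gr' (x k) l = v k \<and> norm l \<le> sgm * norm (v k)"
    using v(2) unfolding eventually_sequentially by blast
  \<comment> \<open>The shift by \<open>N\<close> turns an eventual property into one for every
    index, as the choice of the sequence \<open>l\<close> requires.\<close>
  then have "\<forall>k. \<exists>l. l \<in> soc_polar \<and> jacT g0' gr' (x (k + N)) l = v (k + N) \<and> norm l \<le> sgm * norm (v (k + N))"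
    by simp
  then obtain l where l: "\<And>k. l k \<in> soc_polar" "\<And>k. jacT g0' gr' (x (k + N)) (l k) = v (k + N)"
    "\<And>k. norm (l k) \<le> sgm * norm (v (k + N))" by metis
  have "Bseq v" using v(1) by (intro convergent_imp_Bseq convergentI)
  then obtain K where K: "\<And>k. norm (v k) \<le> K" by (rule BseqE) blast
  have "norm (l k) \<le> sgm * K" for k
    using l(3)[of k] K[of "k + N"] sgm_pos by (meson mult_left_mono order_less_imp_le order_trans)
  then have "bounded (range l)" by (auto simp: bounded_iff)
  then obtain L r where r: "strict_mono r" and L: "(\<lambda>k. l (r k)) \<longlonglongrightarrow> L"
    by (rule convergent_subseq_bounded)
  have sub: "filterlim (\<lambda>k. r k + N) sequentially sequentially"
    by (rule filterlim_compose[OF filterlim_add_const_nat_at_top filterlim_subseq[OF r]])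
  have "(\<lambda>k. jacT g0' gr' (x (r k + N)) (l (r k))) \<longlonglongrightarrow> jacT g0' gr' xb L"
    by (intro jacT_tendsto L filterlim_compose[OF x sub])
  moreover have "(\<lambda>k. v (r k + N)) \<longlonglongrightarrow> - f' xb" by (rule filterlim_compose[OF v(1) sub])
  ultimately have "jacT g0' gr' xb L = - f' xb" unfolding l(2) by (rule LIMSEQ_unique)
  moreover have "L \<in> soc_polar" using closed_sequentially[OF closed_soc_polar l(1) L] .
  ultimately show thesis using that by blast
qed

lemma KKT_bounded:
  assumes x: "x \<longlonglongrightarrow> xb" and v: "v \<longlonglongrightarrow> 0" and KKT: "\<And>k. KKT (v k) (x k) (l k)"
  shows "bounded (range l)"
proof -
  have "(\<lambda>k. v k - f' (x k)) \<longlonglongrightarrow> 0 - f' xb"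
    by (intro tendsto_diff v C2_gradient_tendsto[OF f_C2 x])
  from convergent_imp_Bseq[OF convergentI[OF this]]
  obtain K where K: "\<And>k. norm (v k - f' (x k)) \<le> K" by (rule BseqE) blast
  have "norm (l k) \<le> sgm * K" for k
  proof -
    have "norm (l k) \<le> sgm * norm (v k - f' (x k))"
      by (rule KKT_norm[OF KKT])
    also have "\<dots> \<le> sgm * K" using K sgm_pos by simp
    finally show ?thesis .
  qed
  then show ?thesis by (auto simp: bounded_iff)
qed

lemma KKT_limit:
  assumes x: "x \<longlonglongrightarrow> xb" and v: "v \<longlonglongrightarrow> 0" and l: "l \<longlonglongrightarrow> L" and KKT: "\<And>k. KKT (v k) (x k) (l k)"
  shows "L \<in> soc_polar" "jacT g0' gr' xb L = - f' xb" "f' xb = 0 \<Longrightarrow> L = 0"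
proof -
  show "L \<in> soc_polar"
    by (rule closed_sequentially[OF closed_soc_polar _ l]) (use KKT in \<open>auto simp: KKT_def\<close>)
  have J: "jacT g0' gr' (x k) (l k) = v k - f' (x k)" for k
    using KKT_gradient[OF KKT[of k]] .
  have lim: "(\<lambda>k. v k - f' (x k)) \<longlonglongrightarrow> 0 - f' xb"
    by (intro tendsto_diff v C2_gradient_tendsto[OF f_C2 x])
  show "jacT g0' gr' xb L = - f' xb"
    using LIMSEQ_unique[OF jacT_tendsto[OF x l, unfolded J] lim] by (simp only: diff_0)
  have "norm (l k) \<le> sgm * norm (v k - f' (x k))" for k
    by (rule KKT_norm[OF KKT])
  moreover have "(\<lambda>k. sgm * norm (v k - f' (x k))) \<longlonglongrightarrow> sgm * norm (0 - f' xb)"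
    by (intro tendsto_intros lim)
  ultimately have "norm L \<le> sgm * norm (0 - f' xb)" using tendsto_norm[OF l] by (meson LIMSEQ_le)
  then show "f' xb = 0 \<Longrightarrow> L = 0" by simp
qed

lemma KKT_directional_limit:
  assumes x: "x \<longlonglongrightarrow> xb" "\<And>k. x k \<noteq> xb" and w: "(\<lambda>k. sgn (x k - xb)) \<longlonglongrightarrow> w"
    and v: "v \<longlonglongrightarrow> 0" and l: "l \<longlonglongrightarrow> L" and KKT: "\<And>k. KKT (v k) (x k) (l k)"
  shows "w \<in> critical_cone Gam xb (- f' xb) \<inter> sphere 0 1"
    and "L \<in> dir_mult_set g0 gr g0' gr' g0'' gr'' xb (- f' xb) w"
    and "DG xb w \<in> soc" "L \<bullet> DG xb w = 0"
proof -
  note lim = KKT_limit[OF x(1) v l KKT]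
  have *: "\<And>k. x k \<in> Gam" "\<And>k. l k \<in> soc_polar" "\<And>k. l k \<bullet> G (x k) = 0"
    using KKT by (auto simp: KKT_def)
  have **: "jacT g0' gr' xb L = 0 \<Longrightarrow> L = 0" using lim by simp
  note D = directional_multiplier_limit[OF x(1) *(1) x(2) w l *(2,3) **, unfolded lim(2)]
  from D show "w \<in> critical_cone Gam xb (- f' xb) \<inter> sphere 0 1"
    and "L \<in> dir_mult_set g0 gr g0' gr' g0'' gr'' xb (- f' xb) w"
    and "DG xb w \<in> soc" "L \<bullet> DG xb w = 0" by blast+
qed

section \<open>Strong monotonicity near \<open>xb\<close>\<close>

text \<open>The flag \<open>b\<close> records whether the first point is always or never
  \<open>xb\<close>. If it always is, \<open>sgn (x k - xb)\<close> is \<open>0\<close>,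
  \<open>wx\<close> is no direction, and the second-order condition is directly available only for
  \<open>M\<close>.\<close>

lemma no_bad_pairs_convergent:
  assumes x: "x \<longlonglongrightarrow> xb" and y: "y \<longlonglongrightarrow> xb" and ne: "\<And>k. x k \<noteq> y k"
    and w: "(\<lambda>k. sgn (y k - x k)) \<longlonglongrightarrow> w"
    and wx: "(\<lambda>k. sgn (x k - xb)) \<longlonglongrightarrow> wx" and wy: "(\<lambda>k. sgn (y k - xb)) \<longlonglongrightarrow> wy"
    and v: "v \<longlonglongrightarrow> 0" and u: "u \<longlonglongrightarrow> 0"
    and l: "l \<longlonglongrightarrow> L" and m: "m \<longlonglongrightarrow> M"
    and Kx: "\<And>k. KKT (v k) (x k) (l k)" and Ky: "\<And>k. KKT (u k) (y k) (m k)"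
    and le: "\<And>k. (u k - v k) \<bullet> (y k - x k) \<le> 1 / kappa * (norm (y k - x k))\<^sup>2"
    and yb: "\<And>k. y k \<noteq> xb" and b: "\<And>k. (x k = xb) = b"
  shows False
proof -
  have fx: "\<And>k. x k \<in> Gam" "\<And>k. l k \<in> soc_polar" "\<And>k. l k \<bullet> G (x k) = 0"
    and fy: "\<And>k. y k \<in> Gam" "\<And>k. m k \<in> soc_polar" "\<And>k. m k \<bullet> G (y k) = 0"
    using Kx Ky by (auto simp: KKT_def)
  have vx: "v k = f' (x k) + jacT g0' gr' (x k) (l k)" and uy: "u k = f' (y k) + jacT g0' gr' (y k) (m k)" for k
    using Kx[of k] Ky[of k] by (simp_all add: KKT_def)
  have le': "((f' (y k) + jacT g0' gr' (y k) (m k)) - (f' (x k) + jacT g0' gr' (x k) (l k))) \<bullet> (y k - x k)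
      \<le> 1 / kappa * (norm (y k - x k))\<^sup>2" for k
    using le[of k] unfolding vx uy .
  note B = monotonicity_limit[where x = x and y = y and w = w and l = l and L = L and m = m and M = M
      and c = "1 / kappa", OF x y ne w fx(1) fy(1) l fx(2,3) m fy(2,3) le']
  have "norm (sgn (y k - x k)) = 1" for k using ne[of k] by (auto simp: norm_sgn)
  then have nw: "norm w = 1" using tendsto_norm[OF w] by (simp add: LIMSEQ_const_iff)
  have My: "1 / kappa < (f'' xb *v w) \<bullet> w + M \<bullet> D2G w"
    by (rule sosc_at[OF KKT_directional_limit(1,2)[OF y yb wy u m Ky] nw B(3,4)])
  note limL = KKT_limit[OF x v l Kx] and limM = KKT_limit[OF y u m Ky]
  show False
  proof (cases "b \<and> L \<noteq> M")
    \<comment> \<open>Either \<open>x k\<close> has a direction of approach or \<open>L = M\<close>,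
      so both limits satisfy the second-order condition and their average contradicts
      \<open>B(5)\<close>.\<close>
    case False
    have "1 / kappa < (f'' xb *v w) \<bullet> w + L \<bullet> D2G w"
    proof (cases b)
      case True
      then show ?thesis using False My by simp
    next
      case False
      then have "\<And>k. x k \<noteq> xb" using b by blast
      then show ?thesis
        by (intro sosc_at[OF KKT_directional_limit(1,2)[OF x _ wx v l Kx] nw B(1,2)])
    qed
    with My B(5) show False by argo
  next
    case True
    then have xk: "x k = xb" for k using b by blast
    \<comment> \<open>At \<open>xb\<close> the limit \<open>L\<close> need not be a directional multiplier, but \<open>l k\<close> may be exchanged for
      multipliers of the same tilt that converge to a point arbitrarily close to \<open>M\<close>.\<close>
    have "f' xb \<noteq> 0" using True limL(3) limM(3) by auto
    have "(f'' xb *v w) \<bullet> w + (((1 - e) * (M \<bullet> D2G w) + e * (L \<bullet> D2G w)) + M \<bullet> D2G w) / 2 \<le> 1 / kappa"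
      if e: "0 < e" "e < 1" for e
    proof -
      \<comment> \<open>\<open>M\<close> may lie on the boundary of the polar cone, but for
        \<open>0 < e\<close> this combination is interior, so \<open>n + (l k - L)\<close> is polar
        for large \<open>k\<close>.\<close>
      define n where "n = (1 - e) *\<^sub>R M + e *\<^sub>R L"
      have int: "norm (snd n) < - fst n"
        unfolding n_def using True limL limM \<open>f' xb \<noteq> 0\<close> e
        by (intro soc_polar_strict_convex[OF limM(1) limL(1) _ _ linear_jacT[of xb]]) auto
      have Jn: "jacT g0' gr' xb n = jacT g0' gr' xb L"
        using limL(2) limM(2) unfolding n_def linear_add[OF linear_jacT] linear_cmul[OF linear_jacT]
        by (simp add: algebra_simps)
      have "(\<lambda>k. norm (snd (n + (l k - L))) + fst (n + (l k - L))) \<longlonglongrightarrow> norm (snd (n + (L - L))) + fst (n + (L - L))"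
        by (intro tendsto_intros l)
      then have "\<forall>\<^sub>F k in sequentially. norm (snd (n + (l k - L))) + fst (n + (l k - L)) < 0"
        by (rule order_tendstoD) (use int in simp)
      then have "\<forall>\<^sub>F k in sequentially. n + (l k - L) \<in> soc_polar"
        by eventually_elim (simp add: soc_polar_iff)
      then obtain N where "\<And>k. k \<ge> N \<Longrightarrow> n + (l k - L) \<in> soc_polar"
        unfolding eventually_sequentially by blast
      then have N: "n + (l (k + N) - L) \<in> soc_polar" for k by simp
      have l': "(\<lambda>k. n + (l (k + N) - L)) \<longlonglongrightarrow> n + (L - L)"
        by (intro tendsto_intros LIMSEQ_ignore_initial_segment l)
      \<comment> \<open>The Jacobian is the one at \<open>xb\<close> for every \<open>k\<close>, and
        there \<open>n\<close> and \<open>L\<close> have the same image; so the exchange keeps the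
        tilt.\<close>
      have Jl: "jacT g0' gr' (x k) (n + (l j - L)) = jacT g0' gr' (x k) (l j)" for k j
        using Jn unfolding xk linear_add[OF linear_jacT] linear_diff[OF linear_jacT] by simp
      have "(f'' xb *v w) \<bullet> w + ((n + (L - L)) \<bullet> D2G w + M \<bullet> D2G w) / 2 \<le> 1 / kappa"
      proof (rule monotonicity_limit(5)[where x = "\<lambda>k. x (k + N)" and y = "\<lambda>k. y (k + N)" and w = w
            and l = "\<lambda>k. n + (l (k + N) - L)" and m = "\<lambda>k. m (k + N)" and M = M and c = "1 / kappa", OF LIMSEQ_ignore_initial_segment[OF x] LIMSEQ_ignore_initial_segment[OF y] ne
            LIMSEQ_ignore_initial_segment[OF w] fx(1) fy(1) l' N _ LIMSEQ_ignore_initial_segment[OF m] fy(2,3)])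
        show "(n + (l (k + N) - L)) \<bullet> G (x (k + N)) = 0" for k by (simp add: xk)
      qed (unfold Jl, rule le')
      then show ?thesis by (simp add: n_def inner_add_left)
    qed
    note bound = this
    \<comment> \<open>The sequence starts at 1/2, so that every term is strictly below 1. As it
      tends to \<open>0\<close>, the average turns into the Hessian for \<open>M\<close> alone,
      which \<open>My\<close> excludes.\<close>
    define e where "e k = inverse (real (Suc (Suc k)))" for k
    have e: "0 < e k" "e k < 1" for k unfolding e_def by (simp_all add: inverse_less_1_iff)
    have e0: "e \<longlonglongrightarrow> 0"
      unfolding e_def using LIMSEQ_Suc[OF LIMSEQ_inverse_real_of_nat] by simp
    have "(\<lambda>k. (f'' xb *v w) \<bullet> w + (((1 - e k) * (M \<bullet> D2G w) + e k * (L \<bullet> D2G w)) + M \<bullet> D2G w) / 2)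
       \<longlonglongrightarrow> (f'' xb *v w) \<bullet> w + (((1 - 0) * (M \<bullet> D2G w) + 0 * (L \<bullet> D2G w)) + M \<bullet> D2G w) / 2"
      by (intro tendsto_intros e0) simp
    then have "(f'' xb *v w) \<bullet> w + (((1 - 0) * (M \<bullet> D2G w) + 0 * (L \<bullet> D2G w)) + M \<bullet> D2G w) / 2 \<le> 1 / kappa"
      by (rule LIMSEQ_le_const2) (use bound e in blast)
    with My show False by simp
  qed
qed

lemma no_bad_pairs:
  assumes x: "x \<longlonglongrightarrow> xb" and y: "y \<longlonglongrightarrow> xb" and ne: "\<And>k. x k \<noteq> y k"
    and v: "v \<longlonglongrightarrow> 0" and u: "u \<longlonglongrightarrow> 0"
    and Kx: "\<And>k. KKT (v k) (x k) (l k)" and Ky: "\<And>k. KKT (u k) (y k) (m k)"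
    and le: "\<And>k. (u k - v k) \<bullet> (y k - x k) \<le> 1 / kappa * (norm (y k - x k))\<^sup>2"
    and yb: "\<And>k. y k \<noteq> xb" and b: "\<And>k. (x k = xb) = b"
  shows False
proof -
  \<comment> \<open>All bounded quantities form one product sequence, so that a single subsequence
    makes them converge together.\<close>
  define z where "z k = ((l k, m k), sgn (y k - x k), sgn (x k - xb), sgn (y k - xb))" for k
  have "range z \<subseteq> (range l \<times> range m) \<times> range (\<lambda>k. sgn (y k - x k)) \<times> range (\<lambda>k. sgn (x k - xb)) \<times> range (\<lambda>k. sgn (y k - xb))"
    by (auto simp: z_def)
  then have "bounded (range z)"
    by (rule bounded_subset[rotated])
      (intro bounded_Times KKT_bounded[OF x v Kx] KKT_bounded[OF y u Ky] bounded_range_sgn)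
  then obtain Z r where r: "strict_mono r" and Z: "(\<lambda>k. z (r k)) \<longlonglongrightarrow> Z"
    by (rule convergent_subseq_bounded)
  have "(\<lambda>k. fst (fst (z (r k)))) \<longlonglongrightarrow> fst (fst Z)" "(\<lambda>k. snd (fst (z (r k)))) \<longlonglongrightarrow> snd (fst Z)"
    "(\<lambda>k. fst (snd (z (r k)))) \<longlonglongrightarrow> fst (snd Z)" "(\<lambda>k. fst (snd (snd (z (r k))))) \<longlonglongrightarrow> fst (snd (snd Z))"
    "(\<lambda>k. snd (snd (snd (z (r k))))) \<longlonglongrightarrow> snd (snd (snd Z))"
    by (intro tendsto_fst tendsto_snd Z)+
  note lims = this[unfolded z_def fst_conv snd_conv]
  have sub: "(\<lambda>k. s (r k)) \<longlonglongrightarrow> a" if "s \<longlonglongrightarrow> a" for s and a :: "real^'n"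
    using LIMSEQ_subseq_LIMSEQ[OF that r] by (simp add: o_def)
  show False
    by (rule no_bad_pairs_convergent[OF sub[OF x] sub[OF y] ne lims(3-5) sub[OF v] sub[OF u] lims(1,2) Kx Ky le yb b])
qed

text \<open>Fixing \<open>b\<close> before the radius makes all violating pairs of one kind, as
  \<open>no_bad_pairs\<close> demands.\<close>

lemma strong_monotonicity_aux:
  "\<exists>d>0. \<forall>x y l m v u. norm (x - xb) < d \<longrightarrow> norm (y - xb) < d \<longrightarrow> norm v < d \<longrightarrow> norm u < d \<longrightarrow>
     KKT v x l \<longrightarrow> KKT u y m \<longrightarrow> x \<noteq> y \<longrightarrow> y \<noteq> xb \<longrightarrow> (x = xb) = b \<longrightarrow>
     1 / kappa * (norm (y - x))\<^sup>2 < (u - v) \<bullet> (y - x)"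
proof (rule ccontr)
  assume neg: "\<not> ?thesis"
  have "\<exists>x y l m v u. norm (x - xb) < inverse (real (Suc k)) \<and> norm (y - xb) < inverse (real (Suc k)) \<and>
     norm v < inverse (real (Suc k)) \<and> norm u < inverse (real (Suc k)) \<and>
     KKT v x l \<and> KKT u y m \<and> x \<noteq> y \<and> y \<noteq> xb \<and> (x = xb) = b \<and>
     (u - v) \<bullet> (y - x) \<le> 1 / kappa * (norm (y - x))\<^sup>2" for k
  proof -
    have "inverse (real (Suc k)) > 0" by simp
    with neg show ?thesis by (meson not_less)
  qed
  then obtain x y l m v u where
    x: "\<And>k. norm (x k - xb) < inverse (real (Suc k))" and y: "\<And>k. norm (y k - xb) < inverse (real (Suc k))"
    and v: "\<And>k. norm (v k) < inverse (real (Suc k))" and u: "\<And>k. norm (u k) < inverse (real (Suc k))"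
    and *: "\<And>k. KKT (v k) (x k) (l k)" "\<And>k. KKT (u k) (y k) (m k)" "\<And>k. x k \<noteq> y k" "\<And>k. y k \<noteq> xb"
    "\<And>k. (x k = xb) = b" "\<And>k. (u k - v k) \<bullet> (y k - x k) \<le> 1 / kappa * (norm (y k - x k))\<^sup>2"
    by metis
  have "x \<longlonglongrightarrow> xb" "y \<longlonglongrightarrow> xb" using tendsto_zero_inverse_Suc[OF x] tendsto_zero_inverse_Suc[OF y] by (simp_all add: LIM_zero_cancel)
  then show False using no_bad_pairs[OF _ _ *(3) tendsto_zero_inverse_Suc[OF v] tendsto_zero_inverse_Suc[OF u] *(1,2,6,4,5)] by blast
qed

text \<open>The estimate is symmetric in the two KKT points, so the case \<open>y = xb\<close>
  reduces to the case \<open>x = xb\<close>; then the smaller of the two radii serves.\<close>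

lemma strong_monotonicity:
  obtains d where "d > 0"
    "\<And>x y l m v u. norm (x - xb) < d \<Longrightarrow> norm (y - xb) < d \<Longrightarrow> norm v < d \<Longrightarrow> norm u < d \<Longrightarrow>
     KKT v x l \<Longrightarrow> KKT u y m \<Longrightarrow> x \<noteq> y \<Longrightarrow> 1 / kappa * (norm (y - x))\<^sup>2 < (u - v) \<bullet> (y - x)"
proof -
  obtain d1 where d1: "d1 > 0" and mono1: "\<forall>x y l m v u. norm (x - xb) < d1 \<longrightarrow> norm (y - xb) < d1 \<longrightarrow>
     norm v < d1 \<longrightarrow> norm u < d1 \<longrightarrow> KKT v x l \<longrightarrow> KKT u y m \<longrightarrow> x \<noteq> y \<longrightarrow> y \<noteq> xb \<longrightarrow> (x = xb) = True \<longrightarrow>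
     1 / kappa * (norm (y - x))\<^sup>2 < (u - v) \<bullet> (y - x)"
    using strong_monotonicity_aux[of True] by (elim exE conjE)
  obtain d2 where d2: "d2 > 0" and mono2: "\<forall>x y l m v u. norm (x - xb) < d2 \<longrightarrow> norm (y - xb) < d2 \<longrightarrow>
     norm v < d2 \<longrightarrow> norm u < d2 \<longrightarrow> KKT v x l \<longrightarrow> KKT u y m \<longrightarrow> x \<noteq> y \<longrightarrow> y \<noteq> xb \<longrightarrow> (x = xb) = False \<longrightarrow>
     1 / kappa * (norm (y - x))\<^sup>2 < (u - v) \<bullet> (y - x)"
    using strong_monotonicity_aux[of False] by (elim exE conjE)
  show thesis
  proof (rule that[of "min d1 d2"])
    fix x y l m v u
    assume a: "norm (x - xb) < min d1 d2" "norm (y - xb) < min d1 d2" "norm v < min d1 d2" "norm u < min d1 d2"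
      "KKT v x l" "KKT u y m" "x \<noteq> y"
    show "1 / kappa * (norm (y - x))\<^sup>2 < (u - v) \<bullet> (y - x)"
    proof (cases "y = xb")
      case True
      then have "1 / kappa * (norm (x - y))\<^sup>2 < (v - u) \<bullet> (x - y)"
        using a by (intro mono1[rule_format, of y x u v m l]) simp_all
      moreover have "(v - u) \<bullet> (x - y) = (u - v) \<bullet> (y - x)"
        by (simp add: inner_diff_left inner_diff_right)
      ultimately show ?thesis by (simp add: norm_minus_commute)
    next
      case False
      show ?thesis
      proof (cases "x = xb")
        case True
        then show ?thesis using a False by (intro mono1[rule_format, of x y v u l m]) simp_all
      next
        case xF: False
        then show ?thesis using a False by (intro mono2[rule_format, of x y v u l m]) simp_all
      qed
    qed
  qed (use d1 d2 in auto)
qed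

section \<open>Quadratic bounds and strict local minimality of \<open>xb\<close>\<close>

text \<open>\<open>L\<close> is a fixed multiplier that cancels the gradient of \<open>f\<close> at
  \<open>xb\<close>, so the Lagrangian has no first-order term there.\<close>

lemma lagrangian_limit:
  assumes y: "y \<longlonglongrightarrow> xb" "\<And>k. y k \<noteq> xb" and w: "(\<lambda>k. sgn (y k - xb)) \<longlonglongrightarrow> w"
    and L: "jacT g0' gr' xb L = - f' xb"
  shows "(\<lambda>k. (f (y k) - f xb + L \<bullet> G (y k)) / (norm (y k - xb))\<^sup>2)
    \<longlonglongrightarrow> ((f'' xb *v w) \<bullet> w + L \<bullet> D2G w) / 2"
proof -
  have ne: "\<And>k. xb \<noteq> y k" using y(2) by metis
  have "(\<lambda>k. (f (y k) - f xb - f' xb \<bullet> (y k - xb)) / (norm (y k - xb))\<^sup>2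
      + L \<bullet> ((G (y k) - G xb - DG xb (y k - xb)) /\<^sub>R (norm (y k - xb))\<^sup>2))
      \<longlonglongrightarrow> (f'' xb *v w) \<bullet> w / 2 + L \<bullet> (D2G w /\<^sub>R 2)"
    by (intro tendsto_add tendsto_inner tendsto_const C2_quotient_second_order[OF f_C2] G_second_order y ne w)
  moreover have "L \<bullet> DG xb u = - f' xb \<bullet> u" for u using L by (simp flip: jacT_inner)
  then have "(f (y k) - f xb - f' xb \<bullet> (y k - xb)) / (norm (y k - xb))\<^sup>2
      + L \<bullet> ((G (y k) - G xb - DG xb (y k - xb)) /\<^sub>R (norm (y k - xb))\<^sup>2)
      = (f (y k) - f xb + L \<bullet> G (y k)) / (norm (y k - xb))\<^sup>2" for k
    by (simp only: inner_scaleR_right inner_diff_right[of L] G_xb inner_zero_right diff_0_right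
        divide_inverse_commute inner_minus_left diff_minus_eq_add) (simp add: algebra_simps)
  ultimately show ?thesis by (simp add: add_divide_distrib)
qed

text \<open>On \<open>Gam\<close> the term \<open>L \<bullet> G y\<close> is nonpositive, so a
  decrease of \<open>f\<close> faster than every quadratic would make the quotient in
  \<open>lagrangian_limit\<close> unbounded below. The constant \<open>C\<close> calibrates the
  proximal term in \<open>strict_local_min\<close>.\<close>

lemma quadratic_lower_bound:
  obtains C d where "C > 0" "d > 0"
    "\<And>y. y \<in> Gam \<Longrightarrow> norm (y - xb) < d \<Longrightarrow> f xb - C * (norm (y - xb))\<^sup>2 \<le> f y"
proof (rule ccontr)
  assume neg: "\<not> thesis"
  have "\<exists>y. y \<in> Gam \<and> norm (y - xb) < inverse (real (Suc k)) \<and> f y < f xb - real (Suc k) * (norm (y - xb))\<^sup>2" for k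
  proof (rule ccontr)
    assume "\<not> ?thesis"
    then have "f xb - real (Suc k) * (norm (y - xb))\<^sup>2 \<le> f y"
      if "y \<in> Gam" "norm (y - xb) < inverse (real (Suc k))" for y
      using that by (meson not_less)
    then have thesis by (intro that[of "real (Suc k)" "inverse (real (Suc k))"]) auto
    with neg show False ..
  qed
  then obtain y where y: "\<And>k. y k \<in> Gam" "\<And>k. norm (y k - xb) < inverse (real (Suc k))"
    "\<And>k. f (y k) < f xb - real (Suc k) * (norm (y k - xb))\<^sup>2" by metis
  have ne: "y k \<noteq> xb" for k using y(3)[of k] by auto
  have lim: "y \<longlonglongrightarrow> xb" using tendsto_zero_inverse_Suc[OF y(2)] by (rule LIM_zero_cancel)
  obtain w r where r: "strict_mono r" and w: "(\<lambda>k. sgn (y (r k) - xb)) \<longlonglongrightarrow> w"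
    by (rule convergent_subseq_bounded[OF bounded_range_sgn])
  obtain L where L: "L \<in> soc_polar" "jacT g0' gr' xb L = - f' xb" by (rule stationary_multiplier)
  have yr: "(\<lambda>k. y (r k)) \<longlonglongrightarrow> xb" using LIMSEQ_subseq_LIMSEQ[OF lim r] by (simp add: o_def)
  define q where "q k = (f (y (r k)) - f xb + L \<bullet> G (y (r k))) / (norm (y (r k) - xb))\<^sup>2" for k
  have "convergent q" unfolding q_def using lagrangian_limit[OF yr ne w L(2)] by (rule convergentI)
  from convergent_imp_Bseq[OF this] obtain K where K: "\<And>k. norm (q k) \<le> K" by (rule BseqE) blast
  have "q k < - real k" for k
  proof -
    have n: "(norm (y (r k) - xb))\<^sup>2 > 0" using ne[of "r k"] by simp
    have "L \<bullet> G (y (r k)) \<le> 0" using soc_polar_inner_nonpos[OF L(1)] y(1) by simp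
    moreover have "real k * (norm (y (r k) - xb))\<^sup>2 \<le> real (Suc (r k)) * (norm (y (r k) - xb))\<^sup>2"
      using seq_suble[OF r, of k] by (intro mult_right_mono) auto
    ultimately have "f (y (r k)) - f xb + L \<bullet> G (y (r k)) < - real k * (norm (y (r k) - xb))\<^sup>2"
      using y(3)[of "r k"] by simp
    then show ?thesis using n by (simp add: q_def pos_divide_less_eq)
  qed
  moreover obtain k :: nat where "real k > K" using reals_Archimedean2 by blast
  ultimately have "q k < - K" using less_trans[of "q k" "- real k" "- K"] by simp
  then show False using K[of k] by simp
qed

text \<open>\<open>G\<close> is controlled only near \<open>xb\<close>, so \<open>Gam\<close> may
  fail to be closed globally; compactness holds for small balls. Halving the radius \<open>d\<close>
  leaves room for closed balls.\<close>

lemma regular_radius: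
  obtains r where "r > 0"
    and "\<And>x. norm (x - xb) \<le> r \<Longrightarrow> (f has_derivative (\<lambda>u. f' x \<bullet> u)) (at x)"
    and "\<And>x v. norm (x - xb) \<le> r \<Longrightarrow> v - f' x \<in> regular_normal Gam x \<Longrightarrow> \<exists>l. KKT v x l"
    and "\<And>d. d \<le> r \<Longrightarrow> compact (Gam \<inter> cball xb d)"
proof -
  have "\<forall>\<^sub>F x in nhds xb. (f has_derivative (\<lambda>u. f' x \<bullet> u)) (at x) \<and> (G has_derivative DG x) (at x) \<and>
      (\<forall>v. v - f' x \<in> regular_normal Gam x \<longrightarrow> (\<exists>l. KKT v x l))"
    using f_has_derivative G_has_derivative KKT_exists by (intro eventually_conj)
  then obtain d where d: "d > 0" "\<And>x. dist x xb < d \<Longrightarrow> (f has_derivative (\<lambda>u. f' x \<bullet> u)) (at x) \<and>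
      (G has_derivative DG x) (at x) \<and> (\<forall>v. v - f' x \<in> regular_normal Gam x \<longrightarrow> (\<exists>l. KKT v x l))"
    unfolding eventually_nhds_metric by blast
  show thesis
  proof (rule that[of "d / 2"])
    fix e assume e: "e \<le> d / 2"
    have "continuous_on (cball xb e) G"
    proof (intro continuous_at_imp_continuous_on ballI)
      fix x assume "x \<in> cball xb e"
      then have "(G has_derivative DG x) (at x)" using d e by (simp add: dist_commute)
      then show "isCont G x" by (rule has_derivative_continuous)
    qed
    then have "closed (cball xb e \<inter> G -` soc)"
      by (rule continuous_closed_preimage) (auto simp: closed_soc)
    moreover have "cball xb e \<inter> G -` soc = Gam \<inter> cball xb e" by auto
    ultimately show "compact (Gam \<inter> cball xb e)"
      by (metis bounded_cball bounded_Int compact_eq_bounded_closed)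
  qed (use d in \<open>auto simp: dist_norm\<close>)
qed

text \<open>Points no better than required would accumulate at \<open>xb\<close> with multipliers
  for tilts tending to \<open>0\<close>. Their limit direction satisfies the side conditions, so the
  Lagrangian Hessian exceeds \<open>1 / kappa\<close> there, whereas the Lagrangian quotients stay
  nonpositive.\<close>

lemma strict_local_min:
  obtains d where "d > 0" "\<And>x. x \<in> Gam \<Longrightarrow> norm (x - xb) < d \<Longrightarrow> x \<noteq> xb \<Longrightarrow> f xb < f x"
proof (rule ccontr)
  note intro = that
  assume neg: "\<not> thesis"
  have bad: "\<exists>x\<in>Gam. norm (x - xb) < t \<and> x \<noteq> xb \<and> f x \<le> f xb" if "t > 0" for t
    using neg intro[OF that] by (meson not_less)
  obtain C d where C: "C > 0" "d > 0"
    "\<And>y. y \<in> Gam \<Longrightarrow> norm (y - xb) < d \<Longrightarrow> f xb - C * (norm (y - xb))\<^sup>2 \<le> f y"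
    by (rule quadratic_lower_bound) blast
  obtain r where r: "r > 0"
    and der: "\<And>x. norm (x - xb) \<le> r \<Longrightarrow> (f has_derivative (\<lambda>u. f' x \<bullet> u)) (at x)"
    and mult: "\<And>x v. norm (x - xb) \<le> r \<Longrightarrow> v - f' x \<in> regular_normal Gam x \<Longrightarrow> \<exists>l. KKT v x l"
    and comp: "\<And>d. d \<le> r \<Longrightarrow> compact (Gam \<inter> cball xb d)"
    by (rule regular_radius) blast
  have "\<exists>y v l. KKT v y l \<and> y \<noteq> xb \<and> norm (y - xb) < e \<and> norm v < e \<and> f y \<le> f xb" if "e > 0" for e
  proof -
    define s where "s = min r (d / 2)"
    have s: "s > 0" "s \<le> r" "s < d" using r C by (auto simp: s_def)
    \<comment> \<open>Since \<open>y\<close> below satisfies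
      \<open>norm (y - xb) \<le> 2 * norm (x - xb)\<close>, the first bound keeps \<open>y\<close>
      off the sphere of radius \<open>s\<close> and the second within \<open>e\<close> of
      \<open>xb\<close>. The third keeps the tilt, of norm \<open>8 * C * norm (y - x)\<close>,
      below \<open>e\<close>.\<close>
    define t where "t = min (s / 2) (min (e / 2) (e / (8 * C)))"
    have t: "t > 0" using s \<open>e > 0\<close> C by (simp add: t_def)
    obtain x where x: "x \<in> Gam" "norm (x - xb) < t" "x \<noteq> xb" "f x \<le> f xb"
      using bad[OF t] by blast
    have ts: "t \<le> s / 2" "t \<le> e / 2" "8 * C * t \<le> e"
    proof -
      have "t \<le> e / (8 * C)" by (simp add: t_def)
      then show "8 * C * t \<le> e" using C by (simp add: pos_le_divide_eq mult.commute)
    qed (auto simp: t_def)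
    \<comment> \<open>Proximal regularization: a feasible point that is no worse than \<open>xb\<close> is replaced by
      one of this kind that in addition carries a multiplier.\<close>
    define h where "h y = f y + 4 * C * ((y - x) \<bullet> (y - x))" for y
    have hder: "(h has_derivative (\<lambda>u. (f' y + (8 * C) *\<^sub>R (y - x)) \<bullet> u)) (at y)" if "norm (y - xb) \<le> r" for y
      unfolding h_def using der[OF that]
      by (auto intro!: derivative_eq_intros simp: inner_add_left inner_commute algebra_simps)
    have "continuous_on (Gam \<inter> cball xb s) h"
    proof (intro continuous_at_imp_continuous_on ballI)
      fix y assume "y \<in> Gam \<inter> cball xb s"
      then have "norm (y - xb) \<le> r" using s by (simp add: dist_norm norm_minus_commute)
      from has_derivative_continuous[OF hder[OF this]] show "isCont h y" .
    qed
    moreover have xs: "x \<in> Gam \<inter> cball xb s" using x ts s by (auto simp: dist_norm norm_minus_commute)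
    ultimately obtain y where "y \<in> Gam \<inter> cball xb s" "\<And>z. z \<in> Gam \<inter> cball xb s \<Longrightarrow> h y \<le> h z"
      using continuous_attains_inf[OF comp[OF s(2)], of h] by blast
    then have y: "y \<in> Gam" "norm (y - xb) \<le> s"
      "\<And>z. z \<in> Gam \<Longrightarrow> norm (z - xb) \<le> s \<Longrightarrow> h y \<le> h z"
      by (auto simp: dist_norm norm_minus_commute)
    \<comment> \<open>Combined with the quadratic lower bound and \<open>f x \<le> f xb\<close>, the
      factor 4 gives \<open>2 * norm (y - x) \<le> norm (y - xb)\<close>. Hence \<open>y\<close>
      cannot be \<open>xb\<close> unless \<open>x\<close> is.\<close>
    have hy: "f y + 4 * C * (norm (y - x))\<^sup>2 \<le> f x"
    proof -
      have "norm (x - xb) \<le> s" using xs by (simp add: dist_norm norm_minus_commute)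
      from y(3)[OF x(1) this] show ?thesis by (simp add: h_def power2_norm_eq_inner)
    qed
    moreover have "f xb - C * (norm (y - xb))\<^sup>2 \<le> f y" using C(3)[OF y(1)] y(2) s(3) by simp
    ultimately have "C * (2 * norm (y - x))\<^sup>2 \<le> C * (norm (y - xb))\<^sup>2"
      using x(4) by (simp add: power_mult_distrib)
    then have "(2 * norm (y - x))\<^sup>2 \<le> (norm (y - xb))\<^sup>2"
      by (rule mult_left_le_imp_le) (rule C(1))
    then have "2 * norm (y - x) \<le> norm (y - xb)"
      by (rule power2_le_imp_le) (rule norm_ge_zero)
    moreover have "norm (y - xb) \<le> norm (y - x) + norm (x - xb)"
      using norm_triangle_ineq[of "y - x" "x - xb"] by simp
    ultimately have yx: "norm (y - x) \<le> norm (x - xb)" "norm (y - xb) \<le> 2 * norm (x - xb)"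
      "y = xb \<Longrightarrow> x = xb" by auto
    have "- (f' y + (8 * C) *\<^sub>R (y - x)) \<in> regular_normal Gam y"
    proof (rule local_min_regular_normal[of y Gam h _ "s - norm (y - xb)"])
      show "(h has_derivative (\<lambda>u. (f' y + (8 * C) *\<^sub>R (y - x)) \<bullet> u)) (at y)"
        using hder y(2) s(2) by simp
      show "0 < s - norm (y - xb)" using yx(2) x(2) ts(1) by linarith
      fix z assume z: "z \<in> Gam" "norm (z - y) < s - norm (y - xb)"
      then have "norm (z - xb) \<le> s" using norm_triangle_ineq[of "z - y" "y - xb"] by simp
      then show "h y \<le> h z" using y(3) z by blast
    qed (use y in auto)
    then have "- ((8 * C) *\<^sub>R (y - x)) - f' y \<in> regular_normal Gam y" by (simp add: algebra_simps)
    then obtain l where l: "KKT (- ((8 * C) *\<^sub>R (y - x))) y l" using mult y(2) s(2) by (meson order_trans)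
    have "8 * C * norm (y - x) < 8 * C * t"
      using yx(1) x(2) C(1) by (intro mult_strict_left_mono) auto
    also note ts(3)
    finally have "norm (- ((8 * C) *\<^sub>R (y - x))) < e" using C(1) by simp
    moreover have "f y \<le> f xb" using hy C(1) x(4) by (smt (verit) mult_nonneg_nonneg zero_le_power2)
    moreover have "norm (y - xb) < e" using yx(2) x(2) ts(2) by linarith
    ultimately show ?thesis using l yx(3) x(3) by blast
  qed
  then have "\<exists>y v l. KKT v y l \<and> y \<noteq> xb \<and> norm (y - xb) < inverse (real (Suc k)) \<and>
      norm v < inverse (real (Suc k)) \<and> f y \<le> f xb" for k by simp
  then obtain y v l where KKT: "\<And>k. KKT (v k) (y k) (l k)" and ne: "\<And>k. y k \<noteq> xb"
    and yn: "\<And>k. norm (y k - xb) < inverse (real (Suc k))" and vn: "\<And>k. norm (v k) < inverse (real (Suc k))"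
    and fy: "\<And>k. f (y k) \<le> f xb" by metis
  have y: "y \<longlonglongrightarrow> xb" using tendsto_zero_inverse_Suc[OF yn] by (rule LIM_zero_cancel)
  have v: "v \<longlonglongrightarrow> 0" using tendsto_zero_inverse_Suc[OF vn] .
  have "bounded (range l \<times> range (\<lambda>k. sgn (y k - xb)))"
    by (intro bounded_Times KKT_bounded[OF y v KKT] bounded_range_sgn)
  then have "bounded (range (\<lambda>k. (l k, sgn (y k - xb))))" by (rule bounded_subset) auto
  then obtain Z q where q: "strict_mono q" and Z: "(\<lambda>k. (l (q k), sgn (y (q k) - xb))) \<longlonglongrightarrow> Z"
    by (rule convergent_subseq_bounded)
  define L where "L = fst Z"
  define w where "w = snd Z"
  have L: "(\<lambda>k. l (q k)) \<longlonglongrightarrow> L" and w: "(\<lambda>k. sgn (y (q k) - xb)) \<longlonglongrightarrow> w"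
    using tendsto_fst[OF Z] tendsto_snd[OF Z] by (simp_all add: L_def w_def)
  have yq: "(\<lambda>k. y (q k)) \<longlonglongrightarrow> xb" and vq: "(\<lambda>k. v (q k)) \<longlonglongrightarrow> 0"
    using LIMSEQ_subseq_LIMSEQ[OF y q] LIMSEQ_subseq_LIMSEQ[OF v q] by (simp_all add: o_def)
  note lim = KKT_limit[OF yq vq L KKT] and dir = KKT_directional_limit[OF yq ne w vq L KKT]
  \<comment> \<open>As a limit of feasible directions \<open>DG xb w\<close> lies in the cone, which
    gives the sign opposite to the one in \<open>lorentz_orthogonal\<close>.\<close>
  have "fst L * lorentz (DG xb w) \<le> 0"
    using soc_polar_fst_nonpos[OF lim(1)] lorentz_nonneg[OF dir(3)] by (rule mult_nonpos_nonneg)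
  with lorentz_orthogonal[OF lim(1) dir(4)] have "fst L * lorentz (DG xb w) = 0" by simp
  then have "1 / kappa < (f'' xb *v w) \<bullet> w + L \<bullet> D2G w"
    using dir by (intro sosc_at[OF dir(1,2)]) auto
  moreover have "((f'' xb *v w) \<bullet> w + L \<bullet> D2G w) / 2 \<le> 0"
  proof (rule LIMSEQ_le_const2[OF lagrangian_limit[OF yq ne w lim(2)]], intro exI allI impI)
    fix k
    have "L \<bullet> G (y (q k)) \<le> 0"
      using soc_polar_inner_nonpos[OF lim(1)] KKT[of "q k"] by (simp add: KKT_def)
    then show "(f (y (q k)) - f xb + L \<bullet> G (y (q k))) / (norm (y (q k) - xb))\<^sup>2 \<le> 0"
      using fy[of "q k"] by (intro divide_nonpos_nonneg) auto
  qed
  ultimately have "1 / kappa < 0" by argo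
  then show False using kappa_pos by simp
qed

text \<open>A positive gap of \<open>f\<close> on the sphere of radius \<open>gm\<close> keeps
  minimizers for small tilts in the open ball. They are therefore KKT points, and strong
  monotonicity with Cauchy-Schwarz gives the modulus \<open>kappa\<close>.\<close>

lemma tilt_stable_xb: "tilt_stable f Gam xb kappa"
proof -
  obtain d1 where d1: "d1 > 0"
    "\<And>x y l m v u. norm (x - xb) < d1 \<Longrightarrow> norm (y - xb) < d1 \<Longrightarrow> norm v < d1 \<Longrightarrow> norm u < d1 \<Longrightarrow>
     KKT v x l \<Longrightarrow> KKT u y m \<Longrightarrow> x \<noteq> y \<Longrightarrow> 1 / kappa * (norm (y - x))\<^sup>2 < (u - v) \<bullet> (y - x)"
    by (rule strong_monotonicity) blast
  obtain d2 where d2: "d2 > 0" "\<And>x. x \<in> Gam \<Longrightarrow> norm (x - xb) < d2 \<Longrightarrow> x \<noteq> xb \<Longrightarrow> f xb < f x"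
    by (rule strict_local_min) blast
  obtain r where r: "r > 0"
    and der: "\<And>x. norm (x - xb) \<le> r \<Longrightarrow> (f has_derivative (\<lambda>u. f' x \<bullet> u)) (at x)"
    and mult: "\<And>x v. norm (x - xb) \<le> r \<Longrightarrow> v - f' x \<in> regular_normal Gam x \<Longrightarrow> \<exists>l. KKT v x l"
    and comp: "\<And>d. d \<le> r \<Longrightarrow> compact (Gam \<inter> cball xb d)"
    by (rule regular_radius) blast
  define gm where "gm = min r (min d1 d2 / 2)"
  have gm: "gm > 0" "gm \<le> r" "gm < d1" "gm < d2" using r d1 d2 by (auto simp: gm_def)
  have cball: "z \<in> cball xb gm \<longleftrightarrow> norm (z - xb) \<le> gm" for z by (simp add: dist_norm norm_minus_commute)
  have xbG: "xb \<in> Gam \<inter> cball xb gm" using gm by (simp add: soc_iff)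
  have fcont: "continuous_on (Gam \<inter> cball xb gm) f"
  proof (intro continuous_at_imp_continuous_on ballI)
    fix x assume "x \<in> Gam \<inter> cball xb gm"
    then have "norm (x - xb) \<le> r" using gm cball by auto
    from has_derivative_continuous[OF der[OF this]] show "isCont f x" .
  qed
  have "\<exists>m>0. \<forall>x\<in>Gam. norm (x - xb) = gm \<longrightarrow> f xb + m \<le> f x"
  proof (cases "Gam \<inter> sphere xb gm = {}")
    case True
    then show ?thesis by (intro exI[of _ 1]) (auto simp: dist_norm norm_minus_commute)
  next
    case False
    have "Gam \<inter> sphere xb gm = (Gam \<inter> cball xb gm) \<inter> sphere xb gm" by auto
    then have "compact (Gam \<inter> sphere xb gm)"
      using compact_Int[OF comp[OF gm(2)] compact_sphere] by simp
    moreover have "continuous_on (Gam \<inter> sphere xb gm) f"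
      by (rule continuous_on_subset[OF fcont]) auto
    ultimately obtain x where x: "x \<in> Gam \<inter> sphere xb gm" "\<And>y. y \<in> Gam \<inter> sphere xb gm \<Longrightarrow> f x \<le> f y"
      using continuous_attains_inf[OF _ False, of f] by blast
    have "f xb < f x" using x(1) gm by (intro d2(2)) (auto simp: dist_norm norm_minus_commute)
    then show ?thesis
      using x(2) by (intro exI[of _ "f x - f xb"]) (auto simp: dist_norm norm_minus_commute)
  qed
  then obtain m where m: "m > 0" "\<And>x. x \<in> Gam \<Longrightarrow> norm (x - xb) = gm \<Longrightarrow> f xb + m \<le> f x" by blast
  \<comment> \<open>Relative to \<open>xb\<close>, a tilt \<open>v\<close> changes values on the
    ball by at most \<open>norm v * gm\<close>, which must stay below the gap
    \<open>m\<close>.\<close>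
  define V where "V = ball (0 :: real^'n) (min d1 (m / gm))"
  have KKT: "norm (x - xb) \<le> gm \<and> (\<exists>l. KKT v x l)" if v: "v \<in> V" and x: "x \<in> tilt_argmin f Gam xb gm v" for v x
  proof -
    have xG: "x \<in> Gam" "norm (x - xb) \<le> gm"
      and min: "\<And>y. y \<in> Gam \<Longrightarrow> norm (y - xb) \<le> gm \<Longrightarrow> f x - v \<bullet> x \<le> f y - v \<bullet> y"
      using x unfolding tilt_argmin_def by (auto simp: dist_norm norm_minus_commute)
    have "f x - f xb \<le> v \<bullet> (x - xb)"
      using min[of xb] xbG by (simp add: inner_diff_right)
    also have "\<dots> \<le> norm v * norm (x - xb)" by (rule norm_cauchy_schwarz)
    also have "\<dots> \<le> norm v * gm" using xG by (intro mult_left_mono) auto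
    also have "\<dots> < m" using v gm by (simp add: V_def pos_less_divide_eq)
    finally have "norm (x - xb) \<noteq> gm" using m(2)[OF xG(1)] by linarith
    then have lt: "norm (x - xb) < gm" using xG(2) by simp
    have "- (f' x - v) \<in> regular_normal Gam x"
    proof (rule local_min_regular_normal[of x Gam "\<lambda>y. f y - v \<bullet> y" _ "gm - norm (x - xb)"])
      show "((\<lambda>y. f y - v \<bullet> y) has_derivative (\<lambda>u. (f' x - v) \<bullet> u)) (at x)"
        using der[of x] xG(2) gm(2) by (auto intro!: derivative_eq_intros simp: inner_diff_left)
      fix y assume y: "y \<in> Gam" "norm (y - x) < gm - norm (x - xb)"
      then have "norm (y - xb) \<le> gm" using norm_triangle_ineq[of "y - x" "x - xb"] by simp
      then show "f x - v \<bullet> x \<le> f y - v \<bullet> y" using min y by blast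
    qed (use xG lt in auto)
    then show ?thesis using mult[of x v] xG(2) gm(2) by simp
  qed
  have lip: "dist x y \<le> kappa * dist v u"
    if v: "v \<in> V" "u \<in> V" and x: "x \<in> tilt_argmin f Gam xb gm v" and y: "y \<in> tilt_argmin f Gam xb gm u" for v u x y
  proof (cases "x = y")
    case True
    then show ?thesis using kappa_pos by simp
  next
    case False
    obtain l where l: "KKT v x l" "norm (x - xb) \<le> gm" using KKT[OF v(1) x] by blast
    obtain k where k: "KKT u y k" "norm (y - xb) \<le> gm" using KKT[OF v(2) y] by blast
    have "norm v < d1" "norm u < d1" using v by (auto simp: V_def)
    then have "1 / kappa * (norm (y - x))\<^sup>2 < (u - v) \<bullet> (y - x)"
      using l k gm(3) False by (intro d1(2)[of x y v u l k]) auto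
    also have "\<dots> \<le> norm (u - v) * norm (y - x)" by (rule norm_cauchy_schwarz)
    finally have "norm (y - x) * norm (y - x) < (kappa * norm (u - v)) * norm (y - x)"
      using kappa_pos by (simp add: field_simps power2_eq_square)
    then have "norm (y - x) < kappa * norm (u - v)" using False by simp
    then show ?thesis by (simp add: dist_norm norm_minus_commute)
  qed
  have ex: "\<exists>x. x \<in> tilt_argmin f Gam xb gm v" for v
  proof -
    have "continuous_on (Gam \<inter> cball xb gm) (\<lambda>x. f x - v \<bullet> x)"
      by (intro continuous_intros fcont)
    then show ?thesis
      using continuous_attains_inf[OF comp[OF gm(2)], of "\<lambda>x. f x - v \<bullet> x"] xbG
      unfolding tilt_argmin_def by blast
  qed
  have "0 \<in> V" using d1 m gm by (simp add: V_def)
  \<comment> \<open>Uniqueness is the Lipschitz estimate with equal tilts.\<close>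
  have single: "\<exists>x. tilt_argmin f Gam xb gm v = {x}" if "v \<in> V" for v
  proof -
    obtain x where x: "x \<in> tilt_argmin f Gam xb gm v" using ex by blast
    moreover have "y = x" if "y \<in> tilt_argmin f Gam xb gm v" for y
      using lip[OF \<open>v \<in> V\<close> \<open>v \<in> V\<close> that x] by simp
    ultimately show ?thesis by blast
  qed
  have "xb \<in> tilt_argmin f Gam xb gm 0"
  proof -
    have "f xb \<le> f y" if "y \<in> Gam" "norm (y - xb) \<le> gm" for y
      using d2(2)[of y] that gm(4) by (cases "y = xb") auto
    then show ?thesis using xbG by (simp add: tilt_argmin_def dist_norm norm_minus_commute)
  qed
  then have "tilt_argmin f Gam xb gm 0 = {xb}" using single[OF \<open>0 \<in> V\<close>] by auto
  moreover have "open V" by (simp add: V_def)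
  ultimately show ?thesis
    unfolding tilt_stable_def using gm(1) \<open>0 \<in> V\<close> single lip by (metis insertI1)
qed

end

theorem theorem4p6:
  fixes f :: "real^'n \<Rightarrow> real" and f' :: "real^'n \<Rightarrow> real^'n" and f'' :: "real^'n \<Rightarrow> real^'n^'n"
    and g0 :: "real^'n \<Rightarrow> real" and g0' :: "real^'n \<Rightarrow> real^'n" and g0'' :: "real^'n \<Rightarrow> real^'n^'n"
    and gr :: "real^'n \<Rightarrow> real^'m" and gr' :: "real^'n \<Rightarrow> real^'n^'m"
    and gr'' :: "real^'n \<Rightarrow> 'm \<Rightarrow> real^'n^'n"
    and xb :: "real^'n" and sgm kappa :: real
  defines "Gam \<equiv> {x. (g0 x, gr x) \<in> soc}"
  assumes f_C2: "C2_around f f' f'' xb"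
    and g0_C2: "C2_around g0 g0' g0'' xb"
    and gr_C2: "\<And>i. C2_around (\<lambda>x. gr x $ i) (\<lambda>x. gr' x $ i) (\<lambda>x. gr'' x i) xb"
    and g_xb: "g0 xb = 0" "gr xb = 0"
    and stationary: "- f' xb \<in> limiting_normal Gam xb"
    and sgm_pos: "sgm > 0"
    and mscq: "MSCQ g0 gr xb sgm"
    and kappa_pos: "kappa > 0"
    and SOSC: "\<And>lam u. lam \<in> (\<Union>v \<in> critical_cone Gam xb (- f' xb) \<inter> sphere 0 1.
                   dir_mult_set g0 gr g0' gr' g0'' gr'' xb (- f' xb) v) \<Longrightarrow>
               norm u = 1 \<Longrightarrow>
               fst lam * (g0' xb \<bullet> u) + snd lam \<bullet> (gr' xb *v u) = 0 \<Longrightarrow>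
               fst lam * ((norm (gr' xb *v u))\<^sup>2 - (g0' xb \<bullet> u)\<^sup>2) = 0 \<Longrightarrow>
               ((f'' xb + hess_mult g0'' gr'' xb lam) *v u) \<bullet> u > 1 / kappa"
  shows "tilt_stable f Gam xb kappa"
proof -
  interpret soc_program_sosc f f' f'' g0 g0' g0'' gr gr' gr'' xb sgm kappa
    by unfold_locales (fact f_C2 g0_C2 gr_C2 g_xb sgm_pos mscq kappa_pos stationary[unfolded Gam_def]
        | (rule SOSC[unfolded Gam_def]; assumption))+
  show ?thesis using tilt_stable_xb unfolding Gam_def G_def .
qed

end
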